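(* Let $p\ge 3$ be an integer and let $t\in[1,p-1]$ be an integer relatively prime to $p$. Let $s\in[1,p-1]$ be the inverse of $t$ modulo $p$, and put $\underline{t}=\min(t,p-t)$ and $\underline{s}=\min(s,p-s)$. Let $q,r,r'$ be any integers satisfying $$r,r'>q>p^2,\qquad q\equiv t\pmod p,\qquad rt\equiv 1\pmod{pq},\qquad r't\equiv -1\pmod{pq},$$ and put $T=\{p,q,r\}$ and $T'=\{p,q,r'\}$. Then $$\mathcal{A}_{T'}=-\mathcal{A}_T,$$ and $A^{\pm}(T)$ and $A(T)$ are as follows. (i) If $t=s=1$, then $A^-(T)=-1$, $A^+(T)=1$, $A(T)=1$. (ii) If $t>1$ and $\underline{s}<\underline{t}$, then $A^-(T)=-\underline{s}-1$, $A^+(T)=\underline{s}+1$, $A(T)=\underline{s}+1$. (iii) If $t>1$, $\underline{s}\ge\underline{t}$ and $(\underline{t},\underline{s})=(t,s)$ or $(\underline{t},\underline{s})=(p-t,p-s)$, then $A^-(T)=-\underline{s}$, $A^+(T)=\underline{s}+1$, $A(T)=\underline{s}+1$. (iv) If $t>1$, $\underline{s}\ge\underline{t}$ and $(\underline{t},\underline{s})=(t,p-s)$ or $(\underline{t},\underline{s})=(p-t,s)$, then $A^-(T)=-\underline{s}-1$, $A^+(T)=\underline{s}$, $A(T)=\underline{s}+1$.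
   Context: For pairwise relatively prime integers $p,q,r\ge 3$ and $T=\{p,q,r\}$, the ternary inclusion-exclusion polynomial is $$Q_T(x)=\frac{(x^{pqr}-1)(x^p-1)(x^q-1)(x^r-1)}{(x^{pq}-1)(x^{qr}-1)(x^{rp}-1)(x-1)},$$ which is a polynomial with integer coefficients of degree $\varphi(T)=(p-1)(q-1)(r-1)$ (for distinct odd primes it is the cyclotomic polynomial $\Phi_{pqr}$). Write $Q_T(x)=\sum_{0\le m\le\varphi(T)}a_mx^m$, and put $\mathcal{A}_T=\{a_m : 0\le m\le \varphi(T)\}$, $A(T)=\max_m|a_m|$, $A^+(T)=\max_m a_m$, $A^-(T)=\min_m a_m$. For a set $\mathcal{A}$ of integers, $-\mathcal{A}=\{-a:a\in\mathcal{A}\}$. The conditions in the theorem imply that the triples $\{p,q,r\}$ and $\{p,q,r'\}$ are each pairwise relatively prime. *)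

theory Defs
  imports
    "HOL-Computational_Algebra.Polynomial"
    "HOL-Number_Theory.Cong"
begin

text \<open>
  Division on integer polynomials returns the quotient whenever the division is exact. For
  pairwise relatively prime p, q, r the denominator below divides the numerator; for other
  arguments the value is irrelevant.
\<close>

definition incl_excl_poly :: "nat \<Rightarrow> nat \<Rightarrow> nat \<Rightarrow> int poly" where
  "incl_excl_poly p q r =
     ((monom 1 (p * q * r) - 1) * (monom 1 p - 1) * (monom 1 q - 1) * (monom 1 r - 1)) div
     ((monom 1 (p * q) - 1) * (monom 1 (q * r) - 1) * (monom 1 (r * p) - 1) * (monom 1 1 - 1))"

definition coeff_set :: "nat \<Rightarrow> nat \<Rightarrow> nat \<Rightarrow> int set" where
  "coeff_set p q r =
     {coeff (incl_excl_poly p q r) m | m. m \<le> (p - 1) * (q - 1) * (r - 1)}"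

definition height :: "nat \<Rightarrow> nat \<Rightarrow> nat \<Rightarrow> int" where
  "height p q r = Max (abs ` coeff_set p q r)"

definition max_coeff :: "nat \<Rightarrow> nat \<Rightarrow> nat \<Rightarrow> int" where
  "max_coeff p q r = Max (coeff_set p q r)"

definition min_coeff :: "nat \<Rightarrow> nat \<Rightarrow> nat \<Rightarrow> int" where
  "min_coeff p q r = Min (coeff_set p q r)"

end

theory Submission
  imports Defs
begin

text \<open>
  Let u be an inverse of r modulo pq and let c be the coefficients of the binary polynomial for p, q.
  Kaplan's formula expresses the coefficient of x^n through c at the residues f(i) of (n - i) u
  modulo pq, with i running over two blocks of length p that lie q apart, truncated at n div r.
  Since r is at least p + q, every combination of a residue of n and a truncation bound is realised,
  so the coefficient set depends on u only; replacing u by - u swaps the two blocks, which gives the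
  sets for T and T'.

  For u = t write f = x p + y q modulo pq. The condition on q makes y drop by 1 and p x grow by q - t
  from one i to the next, while c(f) = [f in S] - [f - 1 in S] for the semigroup S generated by p, q.
  Hence the sum becomes a difference of two nearly identical sums of window functions of length t,
  one of them rotated by s. The two differ only (a) by the rotation of a step function, which
  contributes at most min(s, p - s), and (b) in at most one column, which is pushed across the end of
  the cyclic order of the x and contributes at most 1. Whether (a) and (b) can be extremal
  simultaneously is decided by comparing s or p - s with t or p - t.
\<close>

section \<open>Shifted cyclic windows\<close>

text \<open>The hypothesis q > p^2 separates scales. Neighbouring columns lie about q apart, while
  every correction (m * t for m < p, and the offset between the two sums) is below t * p < q. Hence
  a quotient by q sees at most one carry as m runs through a period, which is the origin of the step
  function, and at most one column can be displaced past 0 or pq. The drop of y per column cancels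
  the growth of the quotient, so up to that carry all columns share one window end b. A window of
  length t jumps only at 0 and at t modulo p, and all columns jump with the same sign, so the
  rotation term is this jump times a signed count of columns. The tension between (a) and (b) is one
  of distance: a maximal (a) prescribes which columns the truncation keeps, hence restricts the
  quotient K at the displaced column e, while a favourable (b) ties K to the window length. For e <
  s and the upper bound these agree exactly when 2s > p and p - s < t. Complementing windows gives
  the lower bound; exchanging the two sums replaces s by p - s.\<close>

definition window :: "int \<Rightarrow> int \<Rightarrow> int \<Rightarrow> int" where
  "window p t y = (if y mod p < t then 1 else 0)"

definition stair :: "int \<Rightarrow> int \<Rightarrow> int" where
  "stair M m = (if M \<le> m then 1 else 0)"

definition shift :: "int \<Rightarrow> int \<Rightarrow> int \<Rightarrow> int" where
  "shift p s m = (m - s) mod p"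

lemma shift_eq:
  assumes "0 \<le> m" "m < p" "0 < s" "s < p"
  shows "shift p s m = (if m < s then m - s + p else m - s)"
proof (cases "m < s")
  case True
  have "(m - s + p) mod p = m - s + p" using assms True by (intro mod_pos_pos_trivial) auto
  then show ?thesis using True by (simp add: shift_def)
next
  case False
  then show ?thesis using assms by (simp add: shift_def)
qed

lemma window_mod: "x mod p = y mod p \<Longrightarrow> window p t x = window p t y"
  by (simp add: window_def)

lemma window_01: "window p t y = 0 \<or> window p t y = 1"
  by (simp add: window_def)

lemma window_diff:
  assumes "0 < t" "t < p"
  shows "window p t b - window p t (b - 1) =
    (if b mod p = 0 then 1 else if b mod p = t then -1 else 0)"
proof -
  define c where "c = b mod p"
  have c: "0 \<le> c" "c < p" using assms by (auto simp: c_def)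
  have "(b - 1) mod p = (c - 1) mod p" by (simp add: c_def mod_diff_left_eq)
  also have "\<dots> = (if c = 0 then p - 1 else c - 1)"
    using c assms shift_eq[of c p 1] by (auto simp: shift_def)
  finally show ?thesis using c assms unfolding window_def c_def[symmetric] by auto
qed

text \<open>The complement of a cyclic interval is again a cyclic interval, so an upper bound for
  windows of length p - t yields a lower bound for length t.\<close>

lemma window_flip:
  assumes "0 < t" "t < p"
  shows "window p t y = 1 - window p (p - t) (y - t)"
proof -
  define c where "c = y mod p"
  have c: "0 \<le> c" "c < p" using assms by (auto simp: c_def)
  have "(y - t) mod p = (c - t) mod p" by (simp add: c_def mod_diff_left_eq)
  also have "\<dots> = (if c < t then c - t + p else c - t)"
    using shift_eq[of c p t] c assms by (simp add: shift_def)
  finally show ?thesis using c assms unfolding window_def c_def[symmetric] by auto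
qed

text \<open>Rotation by s moves the columns below s to the top, so the two steps disagree on one
  interval on each side of s; max and min clip the moved threshold M + s to the period.\<close>

lemma sum_stair_shift:
  assumes "0 < s" "s < p" "1 \<le> M" "M \<le> p" and A: "A \<subseteq> {0..<p}"
  shows "(\<Sum>m\<in>A. stair M m - stair M (shift p s m)) =
    int (card (A \<inter> {max s M ..< min p (M + s)})) -
    int (card (A \<inter> {max 0 (M + s - p) ..< min s M}))"
proof -
  have fin: "finite A" using A finite_subset by blast
  have "stair M m - stair M (shift p s m) =
      (if m \<in> {max s M ..< min p (M + s)} then 1 else 0) -
      (if m \<in> {max 0 (M + s - p) ..< min s M} then 1 else 0)" if "m \<in> A" for m
    using that A shift_eq[of m p s] assms(1-4) by (auto simp: stair_def subset_iff)
  then have "(\<Sum>m\<in>A. stair M m - stair M (shift p s m)) =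
     (\<Sum>m\<in>A. (if m \<in> {max s M ..< min p (M + s)} then 1 else 0)) -
     (\<Sum>m\<in>A. (if m \<in> {max 0 (M + s - p) ..< min s M} then 1 else 0))"
    by (simp add: sum_subtractf)
  then show ?thesis using fin by (simp add: sum.If_cases Int_def)
qed

text \<open>The equality clause turns an extremal count into information about individual
  columns.\<close>

lemma card_Int_interval_le:
  fixes l u l' u' :: int
  assumes "l' \<le> l" "u \<le> u'" "l' \<le> u'"
  shows "int (card (A \<inter> {l..<u})) \<le> u' - l'"
    and "int (card (A \<inter> {l..<u})) = u' - l' \<Longrightarrow> A \<inter> {l..<u} = {l'..<u'}"
proof -
  have sub: "A \<inter> {l..<u} \<subseteq> {l'..<u'}" using assms by auto
  have "card (A \<inter> {l..<u}) \<le> card {l'..<u'}" by (rule card_mono) (use sub in auto)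
  then show "int (card (A \<inter> {l..<u})) \<le> u' - l'" using assms by simp
  show "A \<inter> {l..<u} = {l'..<u'}" if "int (card (A \<inter> {l..<u})) = u' - l'"
    by (rule card_subset_eq) (use sub that assms in auto)
qed

lemma card_up_le:
  fixes s M p :: int
  assumes "0 < s" "s < p"
  shows "int (card (A \<inter> {max s M ..< min p (M + s)})) \<le> min s (p - s)"
  using card_Int_interval_le(1)[of s "max s M" "min p (M + s)" p A]
    card_Int_interval_le(1)[of M "max s M" "min p (M + s)" "M + s" A] assms by auto

lemma card_down_le:
  fixes s M p :: int
  assumes "0 < s" "s < p"
  shows "int (card (A \<inter> {max 0 (M + s - p) ..< min s M})) \<le> min s (p - s)"
  using card_Int_interval_le(1)[of 0 "max 0 (M + s - p)" "min s M" s A]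
    card_Int_interval_le(1)[of "M + s - p" "max 0 (M + s - p)" "min s M" "M" A] assms by auto

text \<open>Every function on {0, 1} is affine, so each difference of windows is a difference of
  steps times the slope \<open>window p t b - window p t (b - 1)\<close>, which is the same in all
  columns.\<close>

lemma sum_window_shift:
  "(\<Sum>m\<in>A. window p t (b - stair M (shift p s m)) - window p t (b - stair M m)) =
    (window p t b - window p t (b - 1)) * (\<Sum>m\<in>A. stair M m - stair M (shift p s m))"
  unfolding sum_distrib_left by (rule sum.cong) (auto simp: stair_def)

lemma abs_sum_window_shift_le:
  assumes "0 < t" "t < p" "0 < s" "s < p" "1 \<le> M" "M \<le> p" "A \<subseteq> {0..<p}"
  shows "\<bar>\<Sum>m\<in>A. window p t (b - stair M (shift p s m)) - window p t (b - stair M m)\<bar> \<le> min s (p - s)"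
proof -
  have "\<bar>\<Sum>m\<in>A. stair M m - stair M (shift p s m)\<bar> \<le> min s (p - s)"
    unfolding sum_stair_shift[OF assms(3-7)]
    using card_up_le[OF assms(3,4), of A M] card_down_le[OF assms(3,4), of A M] by linarith
  moreover have "\<bar>window p t b - window p t (b - 1)\<bar> \<le> 1" by (simp add: window_def)
  ultimately show ?thesis
    unfolding sum_window_shift abs_mult
    using mult_mono[of "\<bar>window p t b - window p t (b - 1)\<bar>" 1 "\<bar>\<Sum>m\<in>A. stair M m - stair M (shift p s m)\<bar>" "min s (p-s)"]
    by simp
qed

text \<open>The columns other than e that the truncation keeps in at least one of the two sums:
  \<open>(m - e) mod p\<close> counts steps of q from e, K is the quotient available at e, the step
  functions are carries, and \<open>max\<close> encodes the disjunction.\<close>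

definition active :: "int \<Rightarrow> int \<Rightarrow> int \<Rightarrow> int \<Rightarrow> int \<Rightarrow> int set" where
  "active p s M e K = {m \<in> {0..<p} - {e}.
     (m - e) mod p \<le> K + max (stair M m) (stair M (shift p s m)) - stair M e}"

text \<open>
  The value of the Kaplan sum when column e is pushed across the end of the cyclic order: the rotated
  step function over the active columns, corrected by the two terms that column e contributes alone.
\<close>

definition wrapped_sum :: "int \<Rightarrow> int \<Rightarrow> int \<Rightarrow> int \<Rightarrow> int \<Rightarrow> int \<Rightarrow> int \<Rightarrow> int" where
  "wrapped_sum p t s M e K b =
     (\<Sum>m\<in>active p s M e K. window p t (b - stair M (shift p s m)) - window p t (b - stair M m)) +
     window p t (b - stair M e + 1 + K) - window p t (b - stair M e)"

lemma wrapped_sum_flip: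
  assumes "0 < t" "t < p"
  shows "wrapped_sum p t s M e K b = - wrapped_sum p (p - t) s M e K (b - t)"
proof -
  have w: "window p t y = 1 - window p (p - t) (y - t)" for y by (rule window_flip[OF assms])
  have "(\<Sum>m\<in>active p s M e K. window p t (b - stair M (shift p s m)) - window p t (b - stair M m)) =
     - (\<Sum>m\<in>active p s M e K. window p (p - t) (b - t - stair M (shift p s m)) - window p (p - t) (b - t - stair M m))"
    unfolding w sum_negf[symmetric] by (rule sum.cong) (auto simp: algebra_simps)
  then show ?thesis unfolding wrapped_sum_def w[of "b - stair M e + 1 + K"] w[of "b - stair M e"]
    by (simp add: algebra_simps)
qed

lemma mod_shift_below:
  fixes p m e :: int
  assumes "0 \<le> m" "m < p" "0 \<le> e" "e < p"
  shows "(m - e) mod p = (if m < e then m - e + p else m - e)"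
proof (cases "e = 0")
  case True then show ?thesis using assms by simp
next
  case False then show ?thesis using shift_eq[of m p e] assms by (simp add: shift_def)
qed

text \<open>Exceeding \<open>min s (p - s)\<close> needs a full rotation part together with +1 from
  column e. The former puts whole intervals of columns inside or outside the active set, the latter
  confines K; jointly they force 2s > p and p - s < t.\<close>

lemma wrapped_sum_le:
  assumes t: "0 < t" "t < p" and s: "0 < s" "s < p" "2 * s \<noteq> p"
    and M: "1 \<le> M" "M \<le> p" and e: "0 \<le> e" "e < s" and K: "0 \<le> K" "K < p"
  shows "wrapped_sum p t s M e K b \<le> min s (p - s) + (if 2 * s > p \<and> p - s < t then 1 else 0)"
proof (rule ccontr)
  assume contr: "\<not> ?thesis"
  define A where "A = active p s M e K"
  define S where "S = (\<Sum>m\<in>A. window p t (b - stair M (shift p s m)) - window p t (b - stair M m))"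
  define P where "P = A \<inter> {max s M ..< min p (M + s)}"
  define Q where "Q = A \<inter> {max 0 (M + s - p) ..< min s M}"
  define d where "d = window p t b - window p t (b - 1)"
  have sub: "A \<subseteq> {0..<p}" by (auto simp: A_def active_def)
  have finA: "finite A" using sub finite_subset by blast
  have Sd: "S = d * (int (card P) - int (card Q))"
    unfolding S_def sum_window_shift sum_stair_shift[OF s(1,2) M sub] P_def Q_def d_def ..
  have "S \<le> min s (p - s)"
    using abs_sum_window_shift_le[OF t s(1,2) M sub, of b] unfolding S_def by linarith
  moreover have "S + window p t (b - stair M e + 1 + K) - window p t (b - stair M e) > min s (p - s)"
  proof -
    have "wrapped_sum p t s M e K b > min s (p - s)" using contr by (simp only: split: if_splits)
    then show ?thesis unfolding wrapped_sum_def S_def A_def .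
  qed
  moreover have "window p t (b - stair M e + 1 + K) \<in> {0,1}" "window p t (b - stair M e) \<in> {0,1}"
    by (auto simp: window_def)
  ultimately have S: "S = min s (p - s)" and w1: "window p t (b - stair M e + 1 + K) = 1"
    and w0: "window p t (b - stair M e) = 0"
    by auto
  have notcond: "\<not> (2 * s > p \<and> p - s < t)"
  proof
    assume "2 * s > p \<and> p - s < t"
    then have "wrapped_sum p t s M e K b > min s (p - s) + 1" using contr by simp
    then show False using S w1 w0 unfolding wrapped_sum_def S_def A_def by simp
  qed
  have Ple: "int (card P) \<le> min s (p - s)" "int (card Q) \<le> min s (p - s)"
    unfolding P_def Q_def using card_up_le[OF s(1,2)] card_down_le[OF s(1,2)] by auto
  have act: "(m - e) mod p \<le> K + max (stair M m) (stair M (shift p s m)) - stair M e \<longleftrightarrow> m \<in> A"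
    if "m \<in> {0..<p}" "m \<noteq> e" for m
    using that by (simp add: A_def active_def)
  have eA: "e \<notin> A" by (simp add: A_def active_def)
  have "d = 1 \<or> d = -1 \<or> d = 0" by (auto simp: d_def window_def)
  moreover have "d \<noteq> 0" using S Sd s by auto
  ultimately consider "d = 1" | "d = -1" by blast
  then show False
  proof cases
    case 1
    then have b0: "b mod p = 0" using window_diff[OF t, of b] by (auto simp: d_def split: if_splits)
    have "S = int (card P) - int (card Q)" using Sd 1 by simp
    then have cP: "int (card P) = min s (p - s)" using S Ple by linarith
    \<comment> \<open>The subtracted window of column e vanishes only if e lies past the step. Its
      end is then b - 1, and the added window at b + K equals 1 only for K < t.\<close>
    have "window p t b = 1" using b0 t by (simp add: window_def)
    then have Me: "M \<le> e" using w0 by (auto simp: stair_def split: if_splits)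
    have "(b - stair M e + 1 + K) mod p = (b mod p + K) mod p" using Me by (simp add: stair_def mod_add_left_eq)
    then have Kt: "K < t" using w1 b0 K by (simp add: window_def split: if_splits)
    have ss: "2 * s > p"
    proof (rule ccontr)
      assume "\<not> 2 * s > p"
      then have "int (card P) = (M + s) - M" using cP s by auto
      then have "P = {M ..< M + s}"
        unfolding P_def by (intro card_Int_interval_le(2)) (use s in auto)
      then have "M \<in> P" using s by auto
      then show False using Me e unfolding P_def by auto
    qed
    then have "P = {s ..< p}"
      unfolding P_def by (intro card_Int_interval_le(2)) (use s cP in \<open>auto simp: P_def\<close>)
    \<comment> \<open>Column p - 1 is the active one furthest from e; its distance p - 1 - e is at
      least p - s and must be at most K < t.\<close>
    then have p1: "p - 1 \<in> P" using s by auto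
    then have "p - 1 \<in> A" "p - 1 < M + s" unfolding P_def by auto
    then have "(p - 1 - e) mod p \<le> K + max (stair M (p - 1)) (stair M (shift p s (p - 1))) - stair M e"
      using act[of "p - 1"] e s by auto
    then have "p - 1 - e \<le> K"
      using Me e s shift_eq[of "p-1" p s] mod_shift_below[of "p-1" p e]
      by (auto simp: stair_def split: if_splits)
    then show False using Kt e ss notcond by auto
  next
    case 2
    then have bt: "b mod p = t" using window_diff[OF t, of b] by (auto simp: d_def split: if_splits)
    have "S = int (card Q) - int (card P)" using Sd 2 by simp
    then have cQ: "int (card Q) = min s (p - s)" and "card P = 0" using S Ple by linarith+
    then have P0: "P = {}" unfolding P_def using finA by auto
    have "window p t (b - 1) = 1" using 2 by (auto simp: d_def window_def split: if_splits)
    then have Me: "\<not> M \<le> e" using w0 by (auto simp: stair_def split: if_splits)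
    have "(b - stair M e + 1 + K) mod p = (t + 1 + K) mod p"
      using Me bt by (simp add: stair_def) (metis add.assoc mod_add_left_eq)
    then have "(t + 1 + K) mod p < t" using w1 by (simp add: window_def split: if_splits)
    then have Kt: "p - t - 1 \<le> K"
      using t K by (cases "t + 1 + K < p") auto
    have ss: "2 * s > p"
    proof (rule ccontr)
      assume "\<not> 2 * s > p"
      then have "int (card Q) = s - 0" using cQ s by auto
      then have "Q = {0 ..< s}"
        unfolding Q_def by (intro card_Int_interval_le(2)) (use s in auto)
      then have "e \<in> Q" using e by simp
      then show False using eA unfolding Q_def by simp
    qed
    have "Q = {M + s - p ..< M}"
      unfolding Q_def by (intro card_Int_interval_le(2)) (use s cQ ss in \<open>auto simp: Q_def\<close>)
    then have "M - 1 \<in> Q" using s by auto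
    then have Ms: "M \<le> s" unfolding Q_def by auto
    \<comment> \<open>Column s lies in the interval counted by \<open>P\<close>, which is empty, so
      s is inactive: its distance s - e exceeds K + 1 >= p - t, and again p - s < t.\<close>
    have "s \<in> {max s M ..< min p (M + s)}" using Ms s M by auto
    then have "s \<notin> A" using P0 unfolding P_def by auto
    then have "\<not> (s - e) mod p \<le> K + max (stair M s) (stair M (shift p s s)) - stair M e"
      using act[of s] e s by auto
    moreover have "(s - e) mod p = s - e" using e s by (intro mod_pos_pos_trivial) auto
    moreover have "shift p s s = 0" by (simp add: shift_def)
    moreover have "stair M s = 1" "stair M 0 = 0" "stair M e = 0" using Ms Me M by (auto simp: stair_def)
    ultimately have "s - e > K + 1" by simp
    then show False using Kt ss notcond e by auto
  qed
qed

lemma wrapped_sum_ge: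
  assumes t: "0 < t" "t < p" and s: "0 < s" "s < p" "2 * s \<noteq> p"
    and M: "1 \<le> M" "M \<le> p" and e: "0 \<le> e" "e < s" and K: "0 \<le> K" "K < p"
  shows "- min s (p - s) - (if 2 * s > p \<and> p - s < p - t then 1 else 0) \<le> wrapped_sum p t s M e K b"
  using wrapped_sum_le[of "p - t" p s M e K "b - t"] assms wrapped_sum_flip[OF t, of s M e K b] by auto

text \<open>The parameters make the estimates of the upper bound tight: e = s - 1 is the column
  below s nearest to [s, p), M = p - s makes the steps disagree on all of [s, p), and K = p - s is
  the least quotient that keeps column p - 1 active.\<close>

lemma wrapped_sum_extremal_0:
  assumes t: "0 < t" "t < p" and s: "s < p" "2 * s > p"
  shows "wrapped_sum p t s (p - s) (s - 1) (p - s) 0 = p - s + (if p - s < t then 1 else 0)"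
proof -
  have "m \<in> active p s (p - s) (s - 1) (p - s) \<longleftrightarrow> m \<in> {s..<p}" for m
    using s shift_eq[of m p s] mod_shift_below[of m p "s - 1"]
    by (auto simp: active_def stair_def split: if_splits)
  then have A: "active p s (p - s) (s - 1) (p - s) = {s..<p}" by blast
  have "(\<Sum>m\<in>{s..<p}. stair (p - s) m - stair (p - s) (shift p s m)) = (\<Sum>m\<in>{s..<p}. 1)"
    by (rule sum.cong) (use s shift_eq[of _ p s] in \<open>auto simp: stair_def\<close>)
  then have S: "(\<Sum>m\<in>{s..<p}. stair (p - s) m - stair (p - s) (shift p s m)) = p - s"
    using s by simp
  have d: "window p t 0 - window p t (0 - 1) = 1" using window_diff[OF t, of 0] by simp
  have st: "stair (p - s) (s - 1) = 1" using s by (simp add: stair_def)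
  have "window p t (0 - 1) = 0" using d window_01[of p t 0] window_01[of p t "0 - 1"] by linarith
  moreover have "window p t (0 - 1 + 1 + (p - s)) = (if p - s < t then 1 else 0)"
    using s mod_pos_pos_trivial[of "p - s" p] unfolding window_def by simp
  ultimately show ?thesis
    unfolding wrapped_sum_def A sum_window_shift S d st by simp
qed

lemma wrapped_sum_extremal_t:
  assumes t: "0 < t" "t < p" and s: "s < p" "2 * s > p"
  shows "wrapped_sum p t s (p - s) (s - 1) (p - s) t = - (p - s) - (if p - s < p - t then 1 else 0)"
  using wrapped_sum_extremal_0[of "p - t" p s] assms wrapped_sum_flip[OF t, of s "p - s" "s - 1" "p - s" t] by auto

section \<open>Binary coefficients and Kaplan sums\<close>

text \<open>
  For s q = 1 mod p, the unique y in [0, p) with k = y q modulo p is k s mod p, so k lies in the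
  numerical semigroup generated by p and q iff k is at least q y.
\<close>

definition in_semigroup :: "int \<Rightarrow> int \<Rightarrow> int \<Rightarrow> int \<Rightarrow> int" where
  "in_semigroup p q s k = (if q * ((k * s) mod p) \<le> k then 1 else 0)"

definition bin_coeff :: "int \<Rightarrow> int \<Rightarrow> int \<Rightarrow> int \<Rightarrow> int" where
  "bin_coeff p q s k = in_semigroup p q s k - in_semigroup p q s (k - 1)"

definition trunc_coeff :: "int \<Rightarrow> int \<Rightarrow> int \<Rightarrow> int \<Rightarrow> int \<Rightarrow> int" where
  "trunc_coeff p q s N k = (if k \<le> N then bin_coeff p q s k else 0)"

definition kaplan_sum :: "int \<Rightarrow> int \<Rightarrow> int \<Rightarrow> int \<Rightarrow> int \<Rightarrow> int \<Rightarrow> int" where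
  "kaplan_sum p q s u N v = (\<Sum>i\<in>{0..<p}. trunc_coeff p q s N (((v - i) * u) mod (p * q)) -
     trunc_coeff p q s N (((v - i - q) * u) mod (p * q)))"

text \<open>One column: the entries of the two blocks with the same multiple g of p and with
  q-coordinates y and y - t.\<close>

definition col_diff :: "int \<Rightarrow> int \<Rightarrow> int \<Rightarrow> int \<Rightarrow> int \<Rightarrow> int \<Rightarrow> int" where
  "col_diff p q t N g y = (if g + q * (y mod p) \<le> N then 1 else 0) -
     (if g + q * ((y - t) mod p) \<le> N then 1 else 0)"

lemma mult_mod_le: "0 < p \<Longrightarrow> 0 \<le> q \<Longrightarrow> q * (y mod p) \<le> q * p - (q::int)"
  using mult_left_mono[of "y mod p" "p - 1" q] pos_mod_bound[of p y] by (simp add: right_diff_distrib)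

text \<open>The value \<open>g + q * (y mod p)\<close> is k if k lies in the semigroup and k + pq
  otherwise; the latter exceeds N because k >= -1 and N < pq - 1. So one inequality encodes both
  membership and truncation. The case k = -1 arises because the lemma is also applied to k -
  1.\<close>

lemma in_semigroup_trunc:
  fixes p q :: int
  assumes "0 < p" "0 < q" "-1 \<le> k" "k < p * q" "N < p * q - 1"
    and y: "(k * s) mod p = y mod p" and g: "g = (k - q * y) mod (p * q)"
  shows "(if k \<le> N then in_semigroup p q s k else 0) = (if g + q * (y mod p) \<le> N then 1 else 0)"
proof -
  define Y where "Y = q * (y mod p)"
  have Y: "0 \<le> Y" "Y \<le> p * q - q"
    using assms mult_mod_le[of p q y] by (auto simp: Y_def mult.commute)
  have "k - q * y = k - Y + (p * q) * (- (y div p))"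
    by (simp add: Y_def algebra_simps minus_mult_div_eq_mod[symmetric])
  then have g: "g = (k - Y) mod (p * q)" using g by (metis mod_mult_self2)
  have "g = (if Y \<le> k then k - Y else k - Y + p * q)"
  proof (cases "Y \<le> k")
    case True then show ?thesis using g Y assms by (auto intro!: mod_pos_pos_trivial)
  next
    case False
    have "(k - Y) mod (p * q) = (k - Y + p * q) mod (p * q)" by simp
    also have "\<dots> = k - Y + p * q" using False Y assms by (intro mod_pos_pos_trivial) auto
    finally show ?thesis using False g by simp
  qed
  then show ?thesis using assms Y unfolding in_semigroup_def y Y_def[symmetric] by auto
qed

lemma le_div_iff:
  fixes q :: int
  assumes "0 < q"
  shows "a \<le> x div q \<longleftrightarrow> a * q \<le> x"
proof
  assume "a \<le> x div q"
  then have "a * q \<le> (x div q) * q" using assms by simp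
  also have "\<dots> \<le> x" using pos_mod_sign[OF assms, of x] div_mult_mod_eq[of x q] by linarith
  finally show "a * q \<le> x" .
next
  assume "a * q \<le> x"
  then have "(a * q) div q \<le> x div q" using assms by (intro zdiv_mono1)
  then show "a \<le> x div q" using assms by simp
qed

text \<open>Put a = (N - g) div q + 1. The cyclic intervals [0, a) and [a, a + t) together cover the
  same residues, with multiplicity, as [0, t) and [t, t + a). This trades windows whose length
  depends on N for windows of fixed length t.\<close>

lemma col_diff_eq:
  fixes p q :: int
  assumes "0 < t" "t < p" "0 < q" "0 \<le> g" "N < p * q"
  shows "col_diff p q t N g y = (if g \<le> N then window p t y - window p t (y - 1 - (N - g) div q) else 0)"
proof -
  define x where "x = (N - g) div q"
  define c where "c = y mod p"
  have c: "0 \<le> c" "c < p" using assms by (auto simp: c_def)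
  have le: "g + q * a \<le> N \<longleftrightarrow> a \<le> x" for a
    using le_div_iff[OF assms(3), of a "N - g"] by (auto simp: x_def mult.commute)
  have ct: "(y - t) mod p = (if c < t then c - t + p else c - t)"
    using shift_eq[of c p t] c assms by (simp add: shift_def c_def mod_diff_left_eq)
  show ?thesis
  proof (cases "g \<le> N")
    case False
    then have "x < 0" using le_div_iff[OF assms(3), of 0 "N - g"] by (auto simp: x_def)
    then show ?thesis using False c assms ct unfolding col_diff_def le c_def[symmetric] by auto
  next
    case True
    then have x: "0 \<le> x" using assms by (simp add: x_def pos_imp_zdiv_nonneg_iff)
    have "\<not> p \<le> x" unfolding x_def le_div_iff[OF assms(3)] using assms True by auto
    then have "x < p" by simp
    have "(y - 1 - x) mod p = (c - (1 + x)) mod p" by (simp add: c_def mod_diff_left_eq algebra_simps)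
    also have "\<dots> = (if c \<le> x then c - 1 - x + p else c - 1 - x)"
    proof (cases "x = p - 1")
      case True then show ?thesis using c by simp
    next
      case False then show ?thesis using shift_eq[of c p "1 + x"] c x \<open>x < p\<close> by (auto simp: shift_def)
    qed
    finally have cx: "(y - 1 - x) mod p = (if c \<le> x then c - 1 - x + p else c - 1 - x)" .
    show ?thesis
      using True c x \<open>x < p\<close> assms(1,2)
      unfolding col_diff_def le x_def[symmetric] window_def cx ct c_def[symmetric] by auto
  qed
qed

section \<open>Pairing the two Kaplan blocks into columns\<close>

locale ternary =
  fixes p q t s :: int
  assumes p3: "3 \<le> p" and t: "0 < t" "t < p" and s: "0 < s" "s < p"
    and st: "(s * t) mod p = 1" and q: "p * p < q" and qt: "q mod p = t"
begin

lemma t_mult_p: "t * p + t < q"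
proof -
  have "t * (p + 1) \<le> (p - 1) * (p + 1)" using t p3 by (intro mult_right_mono) auto
  then show ?thesis using q by (simp add: algebra_simps)
qed

lemma t_mult_s: "t \<le> t * s" "t * s \<le> t * p - t"
  using mult_left_mono[of 1 s t] mult_left_mono[of s "p - 1" t] t s by (auto simp: algebra_simps)

lemma p_dvd: "p dvd q - t" "p dvd t * s - 1"
  using qt st t p3 by (metis mod_eq_dvd_iff mod_mod_trivial)
    (metis mod_eq_dvd_iff st mult.commute mod_mod_trivial)

text \<open>As s is invertible modulo p, p = 2s would force s = 1, against p >= 3. Comparing s with
  p - s is therefore always strict.\<close>

lemma two_s: "2 * s \<noteq> p"
proof
  assume "2 * s = p"
  then have "s dvd t * s - 1" using p_dvd(2) by (metis dvd_trans dvd_triv_right)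
  then have "s dvd 1" using dvd_diff[of s "t * s" "t * s - 1"] by simp
  then show False using s p3 \<open>2 * s = p\<close> by auto
qed

lemma q_pos: "0 < q" "p < q" "p * q > 0"
  using q p3 t_mult_p t mult_mono[of 1 t p p] by (auto simp: zero_less_mult_iff intro: order.strict_trans1[of _ "p * p"])

text \<open>Multiplication by s reads off the q-coordinate modulo p, so passing from k to k - 1
  moves y to y - s and changes the multiple of p by q * s - 1. The truncation k <= N becomes k - 1
  <= N - 1.\<close>

lemma trunc_coeff_eq:
  assumes N: "N < p * q - 1"
    and y: "(f * s) mod p = y mod p" and g: "(f - q * y) mod (p * q) = g mod (p * q)"
  shows "trunc_coeff p q s N (f mod (p * q)) =
    (if g mod (p * q) + q * (y mod p) \<le> N then 1 else 0) -
    (if (g + q * s - 1) mod (p * q) + q * ((y - s) mod p) \<le> N - 1 then 1 else 0)"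
proof -
  define k where "k = f mod (p * q)"
  have k: "0 \<le> k" "k < p * q" using q_pos by (auto simp: k_def)
  have kp: "k mod p = f mod p" by (simp add: k_def mod_mod_cancel)
  have y1: "(k * s) mod p = y mod p" using y kp by (metis mod_mult_left_eq)
  have y2: "((k - 1) * s) mod p = (y - s) mod p" using y1 by (metis left_diff_distrib mult_1 mod_diff_left_eq)
  have g1: "g mod (p * q) = (k - q * y) mod (p * q)" using g by (simp add: k_def mod_diff_left_eq)
  have "(k - 1 - q * (y - s)) mod (p * q) = (k - q * y + (q * s - 1)) mod (p * q)" by (simp add: algebra_simps)
  also have "\<dots> = (g + (q * s - 1)) mod (p * q)" using g1 by (metis mod_add_left_eq)
  finally have g2: "(g + q * s - 1) mod (p * q) = (k - 1 - q * (y - s)) mod (p * q)"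
    by (simp add: algebra_simps)
  have "(if k \<le> N then in_semigroup p q s k else 0) = (if g mod (p * q) + q * (y mod p) \<le> N then 1 else 0)"
    by (rule in_semigroup_trunc) (use k p3 q_pos N y1 g1 in auto)
  moreover have "(if k - 1 \<le> N - 1 then in_semigroup p q s (k - 1) else 0) =
      (if (g + q * s - 1) mod (p * q) + q * ((y - s) mod p) \<le> N - 1 then 1 else 0)"
    by (rule in_semigroup_trunc) (use k p3 q_pos N y2 g2 in auto)
  ultimately show ?thesis unfolding k_def[symmetric] trunc_coeff_def bin_coeff_def by (auto split: if_splits)
qed

lemma sum_rotate:
  fixes F :: "int \<Rightarrow> int"
  shows "(\<Sum>i\<in>{0..<p}. F (i + s)) = (\<Sum>m\<in>{0..<p}. F (if m < s then m + p else m))"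
  by (rule sum.reindex_bij_witness[of _ "\<lambda>m. if m < s then m - s + p else m - s"
        "\<lambda>i. if i + s < p then i + s else i + s - p"]) (use s in auto)

text \<open>For f = (v - i) * t and its partner (v - i - q) * t the component f - q * y is the same,
  (q - t) * (i - v), because q = t modulo p moves y by exactly t. Indexing the f - 1 terms by m = i
  + s gives them the coordinate y = v - m of the f terms; what remains is an offset t * s - 1,
  lowered by t * p for m < s.\<close>

lemma kaplan_sum_eq_sum:
  assumes N: "N < p * q - 1"
  shows "kaplan_sum p q s t N v = (\<Sum>m\<in>{0..<p}.
     col_diff p q t N (((q - t) * (m - v)) mod (p * q)) (v - m) -
     col_diff p q t (N - 1)
       (((q - t) * (m - v) + (t * s - (if m < s then t * p else 0)) - 1) mod (p * q)) (v - m))"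
proof -
  define F where "F l = col_diff p q t (N - 1) (((q - t) * (l - v) + t * s - 1) mod (p * q)) (v - l)" for l
  have mt: "(a * t * s) mod p = a mod p" for a
    by (metis mult.assoc mult.commute mod_mult_right_eq mult.right_neutral st)
  have a: "trunc_coeff p q s N (((v - i) * t) mod (p * q)) -
      trunc_coeff p q s N (((v - i - q) * t) mod (p * q)) =
      col_diff p q t N (((q - t) * (i - v)) mod (p * q)) (v - i) - F (i + s)" for i
  proof -
    have 1: "trunc_coeff p q s N (((v - i) * t) mod (p * q)) =
      (if ((q - t) * (i - v)) mod (p * q) + q * ((v - i) mod p) \<le> N then 1 else 0) -
      (if ((q - t) * (i - v) + q * s - 1) mod (p * q) + q * ((v - i - s) mod p) \<le> N - 1 then 1 else 0)"
      by (rule trunc_coeff_eq[OF N mt]) (simp add: algebra_simps)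
    have "((v - i - q) * t * s) mod p = (v - i - q) mod p" by (rule mt)
    also have "\<dots> = (v - i - t) mod p" using qt by (metis mod_diff_right_eq)
    finally have 2: "trunc_coeff p q s N (((v - i - q) * t) mod (p * q)) =
      (if ((q - t) * (i - v)) mod (p * q) + q * ((v - i - t) mod p) \<le> N then 1 else 0) -
      (if ((q - t) * (i - v) + q * s - 1) mod (p * q) + q * ((v - i - t - s) mod p) \<le> N - 1 then 1 else 0)"
      by (intro trunc_coeff_eq[OF N]) (auto simp: algebra_simps)
    have e1: "(q - t) * (i + s - v) + t * s - 1 = (q - t) * (i - v) + q * s - 1" by (simp add: algebra_simps)
    have e2: "v - (i + s) = v - i - s" "v - i - s - t = v - i - t - s" by auto
    show ?thesis unfolding 1 2 F_def e1 e2 col_diff_def by simp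
  qed
  have b: "F (if m < s then m + p else m) = col_diff p q t (N - 1)
       (((q - t) * (m - v) + (t * s - (if m < s then t * p else 0)) - 1) mod (p * q)) (v - m)" for m
  proof (cases "m < s")
    case True
    have "(q - t) * (m + p - v) + t * s - 1 = (q - t) * (m - v) + (t * s - t * p) - 1 + p * q"
      by (simp add: algebra_simps)
    then have "((q - t) * (m + p - v) + t * s - 1) mod (p * q) = ((q - t) * (m - v) + (t * s - t * p) - 1) mod (p * q)"
      by (metis mod_add_self2)
    moreover have "(v - (m + p)) mod p = (v - m) mod p" "(v - (m + p) - t) mod p = (v - m - t) mod p"
      by (simp_all add: mod_eq_dvd_iff)
    ultimately show ?thesis using True unfolding F_def col_diff_def by simp
  next
    case False then show ?thesis by (simp add: F_def algebra_simps)
  qed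
  show ?thesis
    unfolding kaplan_sum_def a sum_subtractf sum_rotate[of F] by (simp only: b)
qed

end

section \<open>Evaluation of the Kaplan sum\<close>

lemma (in ternary) div_minus_one: "- q \<le> x \<Longrightarrow> x < 0 \<Longrightarrow> x div q = -1"
  using div_pos_pos_trivial[of "x + q" q] q_pos div_add_self2[of q x] by auto

text \<open>M is the first column in which m * t produces a carry in the quotient by q, or p if
  there is none.\<close>

locale ternary_window = ternary +
  fixes N v M :: int
  assumes N: "0 \<le> N" "N \<le> p * q - q" and M: "1 \<le> M" "M \<le> p"
    and stair_M: "0 \<le> m \<Longrightarrow> m < p \<Longrightarrow>
      (N + (q - t) * v + m * t) div q = (N + (q - t) * v) div q + stair M m"
begin

text \<open>
  With y = v - m, column m has p x = G m in the first sum and G' m in the second one.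
\<close>

definition "Z = N + (q - t) * v"
text \<open>Common end of the second windows: in v - m - 1 - (N - G m) div q the column index m
  cancels modulo p, up to the carry.\<close>

definition "b = v - 1 - Z div q"
definition "G m = ((q - t) * (m - v)) mod (p * q)"
text \<open>The offset of the second sum. Subtracting it from m * t gives
  \<open>shift p s m * t\<close>, which is why the second sum sees the rotated step
  function.\<close>

definition "\<tau> m = t * s - (if m < s then t * p else 0)"
definition "G' m = (G m + \<tau> m - 1) mod (p * q)"
definition "window_at m = window p t (b - stair M m)"
definition "summand m = (if G m \<le> N then window p t (v - m) - window_at m else 0) -
  (if G' m \<le> N - 1 then window p t (v - m) - window_at (shift p s m) else 0)"

lemma shift_s: "0 \<le> m \<Longrightarrow> m < p \<Longrightarrow> shift p s m = (if m < s then m - s + p else m - s)"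
  using shift_eq[of m p s] s by auto

lemma shift_range: "0 \<le> shift p s m" "shift p s m < p"
  using p3 by (auto simp: shift_def)

lemma shift_times_t: "0 \<le> m \<Longrightarrow> m < p \<Longrightarrow> shift p s m * t = m * t - \<tau> m"
  by (auto simp: shift_s \<tau>_def algebra_simps)

lemma G_range: "0 \<le> G m" "G m < p * q" "0 \<le> G' m" "G' m < p * q"
  using q_pos by (auto simp: G_def G'_def)

lemma G_cong: "\<exists>c. N - G m = Z + m * t - m * q + p * q * c"
proof
  show "N - G m = Z + m * t - m * q + p * q * ((q - t) * (m - v) div (p * q))"
    by (simp add: G_def Z_def minus_div_mult_eq_mod[symmetric] algebra_simps)
qed

lemma G'_cong:
  assumes "0 \<le> m" "m < p"
  shows "\<exists>c. N - 1 - G' m = Z + shift p s m * t - m * q + p * q * c"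
proof -
  obtain c where "N - G m = Z + m * t - m * q + p * q * c" using G_cong by blast
  then have "N - 1 - G' m = Z + shift p s m * t - m * q + p * q * (c + ((G m + \<tau> m - 1) div (p * q)))"
    unfolding G'_def shift_times_t[OF assms] by (simp add: minus_div_mult_eq_mod[symmetric] algebra_simps)
  then show ?thesis by blast
qed

lemma div_at:
  assumes "0 \<le> m" "m < p" "x = Z + m * t + q * c"
  shows "x div q = Z div q + stair M m + c"
  using stair_M[OF assms(1,2)] assms(3) q_pos by (simp add: Z_def)

lemma window_div:
  assumes "0 \<le> m" "m < p" "x = Z + m * t - k * q + p * q * c"
  shows "window p t (v - k - 1 - x div q) = window_at m"
proof -
  have "x = Z + m * t + q * (p * c - k)" using assms(3) by (simp add: algebra_simps)
  then have "x div q = Z div q + stair M m + (p * c - k)" by (rule div_at[OF assms(1,2)])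
  then have "v - k - 1 - x div q = b - stair M m - p * c" by (simp add: b_def)
  then show ?thesis unfolding window_at_def by (intro window_mod) (simp add: mod_eq_dvd_iff)
qed

lemma window_G: "0 \<le> m \<Longrightarrow> m < p \<Longrightarrow> window p t (v - m - 1 - (N - G m) div q) = window_at m"
  using G_cong[of m] window_div[of m "N - G m" m] by blast

lemma window_G': "0 \<le> m \<Longrightarrow> m < p \<Longrightarrow> window p t (v - m - 1 - (N - 1 - G' m) div q) = window_at (shift p s m)"
  using G'_cong[of m] window_div[of "shift p s m" "N - 1 - G' m" m] shift_range by blast

lemma kaplan_sum_eq: "kaplan_sum p q s t N v = (\<Sum>m\<in>{0..<p}. summand m)"
proof -
  have Npq: "N < p * q - 1" using N q_pos p3 by linarith
  show ?thesis
    unfolding kaplan_sum_eq_sum[OF Npq]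
  proof (rule sum.cong, goal_cases)
    case (2 m)
    then have m: "0 \<le> m" "m < p" by auto
    have e: "((q - t) * (m - v) + (t * s - (if m < s then t * p else 0)) - 1) mod (p * q) = G' m"
      unfolding G'_def G_def \<tau>_def by (metis add_diff_eq mod_add_left_eq)
    have "col_diff p q t N (G m) (v - m) = (if G m \<le> N then window p t (v - m) - window_at m else 0)"
      using col_diff_eq[OF t q_pos(1) G_range(1), of N m "v - m"] Npq window_G[OF m] by auto
    moreover have "col_diff p q t (N - 1) (G' m) (v - m) =
        (if G' m \<le> N - 1 then window p t (v - m) - window_at (shift p s m) else 0)"
      using col_diff_eq[OF t q_pos(1) G_range(3), of "N - 1" m "v - m"] Npq window_G'[OF m] by auto
    ultimately show ?case unfolding e summand_def by (simp add: G_def)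
  qed simp
qed

lemma tau_bounds: "\<tau> m < q" "- q < \<tau> m"
  unfolding \<tau>_def using t_mult_p t_mult_s t by (cases "m < s"; simp only: if_True if_False; linarith)+

text \<open>If just one truncation condition holds, the other difference lies in [-q, 0), since the
  offset is below q; its quotient is -1 and the missing bracket is zero anyway. So each condition
  may be replaced by the disjunction, and the common term \<open>window p t (v - m)\<close>
  cancels.\<close>

lemma summand_unwrapped:
  assumes m: "0 \<le> m" "m < p" and nw: "0 \<le> G m + \<tau> m - 1" "G m + \<tau> m - 1 < p * q"
  shows "summand m = (if 0 \<le> N - G m \<or> 0 \<le> N - 1 - G' m then window_at (shift p s m) - window_at m else 0)"
proof -
  have G': "G' m = G m + \<tau> m - 1" unfolding G'_def using nw by (intro mod_pos_pos_trivial)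
  consider "G m \<le> N" "G' m \<le> N - 1" | "G m \<le> N" "\<not> G' m \<le> N - 1" | "\<not> G m \<le> N" "G' m \<le> N - 1"
    | "\<not> G m \<le> N" "\<not> G' m \<le> N - 1" by blast
  then show ?thesis
  proof cases
    case 2
    then have "(N - 1 - G' m) div q = -1" using tau_bounds[of m] by (intro div_minus_one) (auto simp: G')
    then have "window p t (v - m) = window_at (shift p s m)" using window_G'[OF m] by simp
    then show ?thesis using 2 by (simp add: summand_def)
  next
    case 3
    then have "(N - G m) div q = -1" using tau_bounds[of m] by (intro div_minus_one) (auto simp: G')
    then have "window p t (v - m) = window_at m" using window_G[OF m] by simp
    then show ?thesis using 3 by (simp add: summand_def)
  qed (auto simp: summand_def)
qed

lemma unwrapped_bound:
  assumes A: "A \<subseteq> {0..<p}" and nw: "\<And>m. m \<in> A \<Longrightarrow> 0 \<le> G m + \<tau> m - 1 \<and> G m + \<tau> m - 1 < p * q"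
  shows "\<bar>\<Sum>m\<in>A. summand m\<bar> \<le> min s (p - s)"
proof -
  define B where "B = {m \<in> A. 0 \<le> N - G m \<or> 0 \<le> N - 1 - G' m}"
  have "finite A" using A finite_subset by blast
  have "(\<Sum>m\<in>A. summand m) = (\<Sum>m\<in>A. if 0 \<le> N - G m \<or> 0 \<le> N - 1 - G' m then window_at (shift p s m) - window_at m else 0)"
    by (rule sum.cong) (use A nw summand_unwrapped in auto)
  also have "\<dots> = (\<Sum>m\<in>B. window_at (shift p s m) - window_at m)"
    using \<open>finite A\<close> by (simp add: B_def sum.inter_filter)
  finally show ?thesis
    using abs_sum_window_shift_le[OF t s M, of B b] A by (auto simp: B_def window_at_def)
qed

text \<open>A column that wraps around the cyclic order serves as base point: all other
  positions are determined by the distance to it.\<close>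

lemma nonneg_iff:
  assumes "0 \<le> m" "m < p" "0 \<le> e" "e < p" "z = Z + e * t + q * c" "x = z - j * q + (m - e) * t"
  shows "0 \<le> x \<longleftrightarrow> j \<le> z div q + stair M m - stair M e"
proof -
  have z: "z div q = Z div q + stair M e + c" using assms by (intro div_at)
  have "x = Z + m * t + q * (c - j)" using assms(5,6) by (simp add: algebra_simps)
  then have x: "x div q = Z div q + stair M m + (c - j)" using assms(1,2) by (intro div_at)
  have "0 \<le> x \<longleftrightarrow> 0 \<le> x div q" using q_pos by (simp add: pos_imp_zdiv_nonneg_iff)
  then show ?thesis using x z by auto
qed

text \<open>Going cyclically up from e to m adds q - t per column; passing from p - 1 back to 0
  removes p * (q - t), that is, adds t * p modulo pq.\<close>

lemma G_step:
  assumes m: "0 \<le> m" "m < p" and e: "0 \<le> e" "e < p"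
    and g: "G e mod (p * q) = g mod (p * q)"
  defines "x \<equiv> g + (q - t) * ((m - e) mod p) + (if m < e then t * p else 0)"
  assumes "0 \<le> x" "x < p * q"
  shows "G m = x"
proof -
  have "G m = (G e + (q - t) * (m - e)) mod (p * q)"
    unfolding G_def mod_add_left_eq by (simp add: algebra_simps)
  also have "\<dots> = (g + (q - t) * (m - e)) mod (p * q)" using g by (metis mod_add_left_eq)
  also have "g + (q - t) * (m - e) = x + (p * q) * (if m < e then - 1 else 0)"
    using mod_shift_below[OF m e] by (auto simp: x_def algebra_simps)
  also have "\<dots> mod (p * q) = x mod (p * q)" by (rule mod_mult_self2)
  also have "\<dots> = x" using assms(7,8) by (rule mod_pos_pos_trivial)
  finally show ?thesis .
qed

lemma dist_bounds:
  assumes "0 \<le> m" "m < p" "0 \<le> e" "e < p" "m \<noteq> e"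
  shows "q - t \<le> (q - t) * ((m - e) mod p)" "(q - t) * ((m - e) mod p) \<le> p * q - q - t * p + t"
proof -
  have j: "1 \<le> (m - e) mod p" "(m - e) mod p \<le> p - 1"
    using mod_shift_below[OF assms(1-4)] assms by auto
  have qt0: "0 \<le> q - t" using q_pos t by auto
  show "q - t \<le> (q - t) * ((m - e) mod p)" using mult_left_mono[OF j(1) qt0] by simp
  have "(q - t) * ((m - e) mod p) \<le> (q - t) * (p - 1)" using mult_left_mono[OF j(2) qt0] .
  then show "(q - t) * ((m - e) mod p) \<le> p * q - q - t * p + t" by (simp add: algebra_simps)
qed

text \<open>Column e lies within t * p of 0 in the first sum and is pushed below 0 in the second,
  hence to the top, above N. It contributes only its first bracket, while every other column is at
  least q - t away and cannot wrap.\<close>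

lemma wrap_low:
  assumes e: "0 \<le> e" "e < s" and wrap: "G e + \<tau> e - 1 < 0"
  defines "K \<equiv> (N - G e) div q"
  shows "K < 0 \<Longrightarrow> \<bar>kaplan_sum p q s t N v\<bar> \<le> min s (p - s)"
    and "0 \<le> K \<Longrightarrow> kaplan_sum p q s t N v = wrapped_sum p t s M e K b"
    and "K < p"
proof -
  have ep: "e < p" using e s by simp
  have Ge: "G e \<le> t * p - t * s" using wrap e by (simp add: \<tau>_def)
  have G: "G m = G e + (q - t) * ((m - e) mod p) + (if m < e then t * p else 0)"
    and nw: "0 \<le> G m + \<tau> m - 1 \<and> G m + \<tau> m - 1 < p * q"
    if m: "m \<in> {0..<p} - {e}" for m
  proof -
    have m': "0 \<le> m" "m < p" "m \<noteq> e" using m by auto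
    note d = dist_bounds[OF m'(1,2) e(1) ep m'(3)]
    show G: "G m = G e + (q - t) * ((m - e) mod p) + (if m < e then t * p else 0)"
      using d Ge G_range[of e] t_mult_p t_mult_s t q_pos
      by (intro G_step[OF m'(1,2) e(1) ep]; cases "m < e"; simp only: if_True if_False; linarith)
    show "0 \<le> G m + \<tau> m - 1 \<and> G m + \<tau> m - 1 < p * q"
      unfolding G \<tau>_def using d Ge G_range[of e] t_mult_p t_mult_s t q_pos
      by (intro conjI; cases "m < e"; cases "m < s"; simp only: if_True if_False; linarith)
  qed
  obtain c where c: "N - G e = Z + e * t - e * q + p * q * c" using G_cong by blast
  then have base: "N - G e = Z + e * t + q * (p * c - e)" by (simp add: algebra_simps)
  have act: "0 \<le> N - G m \<or> 0 \<le> N - 1 - G' m \<longleftrightarrow> m \<in> active p s M e K"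
    if m: "m \<in> {0..<p} - {e}" for m
  proof -
    have m': "0 \<le> m" "m < p" using m by auto
    have G': "G' m = G m + \<tau> m - 1" unfolding G'_def using nw[OF m] by (intro mod_pos_pos_trivial) auto
    have jt: "((m - e) mod p) * t - (if m < e then t * p else 0) = (m - e) * t"
      using mod_shift_below[OF m' e(1) ep] by (auto simp: algebra_simps)
    have x1: "N - G m = (N - G e) - ((m - e) mod p) * q + (m - e) * t"
      unfolding G[OF m] jt[symmetric] by (simp add: algebra_simps)
    have x2: "N - 1 - G' m = (N - G e) - ((m - e) mod p) * q + (shift p s m - e) * t"
      unfolding G' left_diff_distrib[of "shift p s m"] shift_times_t[OF m'] using x1 by (simp add: algebra_simps)
    show ?thesis
      using nonneg_iff[OF m' e(1) ep base x1] nonneg_iff[OF shift_range e(1) ep base x2] m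
      by (auto simp: active_def K_def)
  qed
  have split: "kaplan_sum p q s t N v = summand e + (\<Sum>m\<in>{0..<p} - {e}. summand m)"
    unfolding kaplan_sum_eq using e ep by (subst sum.remove[of _ e]) auto
  have te: "\<tau> e = t * s - t * p" using e by (simp add: \<tau>_def)
  have G'e: "G' e = G e + \<tau> e - 1 + p * q"
  proof -
    have "p * q - t * p + t * s > 0" using t_mult_p t_mult_s t N by linarith
    then have "(G e + \<tau> e - 1 + p * q) mod (p * q) = G e + \<tau> e - 1 + p * q"
      using wrap G_range(1)[of e] unfolding te by (intro mod_pos_pos_trivial) linarith+
    then show ?thesis by (simp add: G'_def)
  qed
  have "\<not> G' e \<le> N - 1" unfolding G'e te using N G_range(1)[of e] t_mult_p t_mult_s t by linarith
  then have se: "summand e = (if 0 \<le> K then window p t (v - e) - window_at e else 0)"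
    using q_pos by (simp add: summand_def K_def pos_imp_zdiv_nonneg_iff)
  have rest: "\<bar>\<Sum>m\<in>{0..<p} - {e}. summand m\<bar> \<le> min s (p - s)"
    by (rule unwrapped_bound) (use nw in auto)
  have KI: "kaplan_sum p q s t N v = wrapped_sum p t s M e K b" if K: "0 \<le> K"
  proof -
    have "(\<Sum>m\<in>{0..<p} - {e}. summand m) =
      (\<Sum>m\<in>{0..<p} - {e}. if m \<in> active p s M e K then window_at (shift p s m) - window_at m else 0)"
    proof (rule sum.cong, goal_cases)
      case (2 m)
      then show ?case using summand_unwrapped[of m] nw[of m] act[of m] by simp
    qed simp
    also have "\<dots> = (\<Sum>m\<in>active p s M e K. window_at (shift p s m) - window_at m)"
      by (subst sum.inter_filter[symmetric]) (auto intro!: sum.cong simp: active_def)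
    finally have S: "(\<Sum>m\<in>{0..<p} - {e}. summand m) = (\<Sum>m\<in>active p s M e K. window_at (shift p s m) - window_at m)" .
    \<comment> \<open>Eliminating the quotient of Z expresses the first window of column e through b
      and K.\<close>
    have "K = Z div q + stair M e + (p * c - e)" unfolding K_def by (rule div_at[OF e(1) ep base])
    then have "window p t (v - e) = window p t (b - stair M e + 1 + K)"
      by (intro window_mod) (simp add: b_def mod_eq_dvd_iff)
    then show ?thesis unfolding split se S wrapped_sum_def using K by (simp add: window_at_def)
  qed
  then show "0 \<le> K \<Longrightarrow> kaplan_sum p q s t N v = wrapped_sum p t s M e K b" .
  show "K < 0 \<Longrightarrow> \<bar>kaplan_sum p q s t N v\<bar> \<le> min s (p - s)"
    using split se rest by simp
  have "\<not> p \<le> K" unfolding K_def le_div_iff[OF q_pos(1)] using N G_range[of e] q_pos by simp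
  then show "K < p" by simp
qed

text \<open>Mirror case: in the second sum column e is pushed beyond pq and re-enters near 0, so
  only its second bracket survives, with a minus sign. Indexing by \<open>shift p s m\<close>
  exchanges the two sums, which turns s into p - s and e into e - s.\<close>

lemma wrap_high:
  assumes e: "s \<le> e" "e < p" and wrap: "p * q \<le> G e + \<tau> e - 1"
  defines "K \<equiv> (N - 1 - G' e) div q"
  shows "K < 0 \<Longrightarrow> \<bar>kaplan_sum p q s t N v\<bar> \<le> min s (p - s)"
    and "0 \<le> K \<Longrightarrow> kaplan_sum p q s t N v = - wrapped_sum p t (p - s) M (e - s) K b"
    and "K < p"
proof -
  have e0: "0 \<le> e" using e s by simp
  have e': "0 \<le> e - s" "e - s < p" using e s by auto
  have she: "shift p s e = e - s" using shift_s[OF e0 e(2)] e by simp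
  have te: "\<tau> e = t * s" using e by (simp add: \<tau>_def)
  have G'e: "G' e = G e + t * s - 1 - p * q"
  proof -
    have "(G e + t * s - 1 - p * q) mod (p * q) = G e + t * s - 1 - p * q"
      using wrap G_range(2)[of e] t_mult_p t_mult_s t N unfolding te by (intro mod_pos_pos_trivial) linarith+
    then show ?thesis using mod_add_self2[of "G e + t * s - 1 - p * q" "p * q"] by (simp add: G'_def te)
  qed
  have g: "G e mod (p * q) = (G' e + 1 - t * s) mod (p * q)"
    unfolding G'e by (simp add: mod_eq_dvd_iff)
  have Ge: "0 \<le> G' e" "G' e \<le> t * s - 2" using wrap te G'e G_range[of e] by auto
  have G: "G m = G' e + 1 - t * s + (q - t) * ((m - e) mod p) + (if m < e then t * p else 0)"
    and nw: "0 \<le> G m + \<tau> m - 1 \<and> G m + \<tau> m - 1 < p * q"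
    if m: "m \<in> {0..<p} - {e}" for m
  proof -
    have m': "0 \<le> m" "m < p" "m \<noteq> e" using m by auto
    note d = dist_bounds[OF m'(1,2) e0 e(2) m'(3)]
    show G: "G m = G' e + 1 - t * s + (q - t) * ((m - e) mod p) + (if m < e then t * p else 0)"
      using d Ge t_mult_p t_mult_s t q_pos
      by (intro G_step[OF m'(1,2) e0 e(2) g]; cases "m < e"; simp only: if_True if_False; linarith)
    show "0 \<le> G m + \<tau> m - 1 \<and> G m + \<tau> m - 1 < p * q"
      unfolding G \<tau>_def using d Ge t_mult_p t_mult_s t q_pos
      by (intro conjI; cases "m < e"; cases "m < s"; simp only: if_True if_False; linarith)
  qed
  obtain c where c: "N - 1 - G' e = Z + shift p s e * t - e * q + p * q * c" using G'_cong[OF e0 e(2)] by blast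
  then have base: "N - 1 - G' e = Z + (e - s) * t + q * (p * c - e)" unfolding she by (simp add: algebra_simps)
  have act: "0 \<le> N - G m \<or> 0 \<le> N - 1 - G' m \<longleftrightarrow> shift p s m \<in> active p (p - s) M (e - s) K"
    if m: "m \<in> {0..<p} - {e}" for m
  proof -
    have m': "0 \<le> m" "m < p" using m by auto
    have G': "G' m = G m + \<tau> m - 1" unfolding G'_def using nw[OF m] by (intro mod_pos_pos_trivial) auto
    have jt: "((m - e) mod p) * t - (if m < e then t * p else 0) = (m - e) * t"
      using mod_shift_below[OF m' e0 e(2)] by (auto simp: algebra_simps)
    have x1: "N - G m = (N - 1 - G' e) - ((m - e) mod p) * q + (m - (e - s)) * t"
      unfolding G[OF m] using jt by (simp add: algebra_simps)
    have x2: "N - 1 - G' m = (N - 1 - G' e) - ((m - e) mod p) * q + (shift p s m - (e - s)) * t"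
      unfolding G' left_diff_distrib[of "shift p s m"] shift_times_t[OF m'] using x1 by (simp add: algebra_simps)
    have ss: "shift p (p - s) (shift p s m) = m"
      using shift_s[OF m'] shift_eq[of "shift p s m" p "p - s"] shift_range[of m] s m' by (auto split: if_splits)
    have sj: "(shift p s m - (e - s)) mod p = (m - e) mod p"
      using shift_s[OF m'] by (auto simp: mod_eq_dvd_iff)
    have ne: "shift p s m \<noteq> e - s" using shift_s[OF m'] m e m' by (auto split: if_splits)
    have "shift p s m \<in> active p (p - s) M (e - s) K \<longleftrightarrow>
        (m - e) mod p \<le> K + max (stair M (shift p s m)) (stair M m) - stair M (e - s)"
      using ne shift_range[of m] by (simp add: active_def ss sj)
    then show ?thesis
      using nonneg_iff[OF m' e' base x1] nonneg_iff[OF shift_range e' base x2]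
      unfolding K_def by auto
  qed
  have split: "kaplan_sum p q s t N v = summand e + (\<Sum>m\<in>{0..<p} - {e}. summand m)"
    unfolding kaplan_sum_eq using e e0 by (subst sum.remove[of _ e]) auto
  have "\<not> G e \<le> N" using N wrap t_mult_s t_mult_p t unfolding te by linarith
  then have se: "summand e = - (if 0 \<le> K then window p t (v - e) - window_at (e - s) else 0)"
    using q_pos by (simp add: summand_def K_def she pos_imp_zdiv_nonneg_iff)
  have rest: "\<bar>\<Sum>m\<in>{0..<p} - {e}. summand m\<bar> \<le> min s (p - s)"
    by (rule unwrapped_bound) (use nw in auto)
  have KI: "kaplan_sum p q s t N v = - wrapped_sum p t (p - s) M (e - s) K b" if K: "0 \<le> K"
  proof -
    let ?f = "\<lambda>m. if m \<in> active p (p - s) M (e - s) K then window_at m - window_at (shift p (p - s) m) else 0"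
    have "(\<Sum>m\<in>{0..<p} - {e}. summand m) = (\<Sum>m\<in>{0..<p} - {e - s}. ?f m)"
    proof (rule sum.reindex_bij_witness[of _ "shift p (p - s)" "shift p s"])
      fix m assume m: "m \<in> {0..<p} - {e}"
      then have m': "0 \<le> m" "m < p" by auto
      show ss: "shift p (p - s) (shift p s m) = m"
        using shift_s[OF m'] shift_eq[of "shift p s m" p "p - s"] shift_range[of m] s m' by (auto split: if_splits)
      show "shift p s m \<in> {0..<p} - {e - s}"
        using shift_s[OF m'] shift_range[of m] m e m' by (auto split: if_splits)
      show "?f (shift p s m) = summand m"
        using summand_unwrapped[OF m'] nw[OF m] act[OF m] unfolding ss by simp
    next
      fix m assume m: "m \<in> {0..<p} - {e - s}"
      then have m': "0 \<le> m" "m < p" by auto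
      have sm: "shift p (p - s) m = (if m < p - s then m - (p - s) + p else m - (p - s))"
        using shift_eq[OF m', of "p - s"] s by auto
      then show "shift p (p - s) m \<in> {0..<p} - {e}" using m s e by (auto split: if_splits)
      then show "shift p s (shift p (p - s) m) = m"
        using sm shift_s[of "shift p (p - s) m"] m' s by (auto split: if_splits)
    qed
    also have "\<dots> = (\<Sum>m\<in>active p (p - s) M (e - s) K. window_at m - window_at (shift p (p - s) m))"
      by (subst sum.inter_filter[symmetric]) (auto intro!: sum.cong simp: active_def)
    also have "\<dots> = - (\<Sum>m\<in>active p (p - s) M (e - s) K. window_at (shift p (p - s) m) - window_at m)"
      by (simp add: sum_negf[symmetric])
    finally have S: "(\<Sum>m\<in>{0..<p} - {e}. summand m) =
      - (\<Sum>m\<in>active p (p - s) M (e - s) K. window_at (shift p (p - s) m) - window_at m)" .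
    have "K = Z div q + stair M (e - s) + (p * c - e)" unfolding K_def by (rule div_at[OF e' base])
    then have "window p t (v - e) = window p t (b - stair M (e - s) + 1 + K)"
      by (intro window_mod) (simp add: b_def mod_eq_dvd_iff)
    then show ?thesis unfolding split se S wrapped_sum_def using K by (simp add: window_at_def)
  qed
  then show "0 \<le> K \<Longrightarrow> kaplan_sum p q s t N v = - wrapped_sum p t (p - s) M (e - s) K b" .
  show "K < 0 \<Longrightarrow> \<bar>kaplan_sum p q s t N v\<bar> \<le> min s (p - s)"
    using split se rest by simp
  have "\<not> p \<le> K" unfolding K_def le_div_iff[OF q_pos(1)] using N G_range[of e] q_pos by simp
  then show "K < p" by simp
qed

end

section \<open>Extremal values\<close>

lemma wrapped_sum_mod:
  assumes "b mod p = b' mod p"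
  shows "wrapped_sum p t s M e K b = wrapped_sum p t s M e K b'"
proof -
  have w: "window p t (b + x) = window p t (b' + x)" for x by (rule window_mod) (metis assms mod_add_left_eq)
  have "window p t (b - x) = window p t (b' - x)" "window p t (b - x + 1 + K) = window p t (b' - x + 1 + K)" for x
    using w[of "- x"] w[of "- x + 1 + K"] by (simp_all add: algebra_simps)
  then show ?thesis unfolding wrapped_sum_def by simp
qed

context ternary
begin

lemma ex_window:
  assumes "0 \<le> N" "N \<le> p * q - q"
  obtains M where "ternary_window p q t s N v M"
proof -
  define Z where "Z = N + (q - t) * v"
  define \<rho> where "\<rho> = Z mod q"
  \<comment> \<open>The least m with \<rho> + m * t >= q, written as a ceiling. A second carry is
    impossible because \<rho> + m * t < 2q.\<close>
  define M0 where "M0 = (q - \<rho> + t - 1) div t"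
  have rho: "0 \<le> \<rho>" "\<rho> < q" using q_pos by (auto simp: \<rho>_def)
  have M0: "M0 \<le> m \<longleftrightarrow> q - \<rho> \<le> m * t" for m
  proof -
    have "m + 1 \<le> M0 \<longleftrightarrow> (m + 1) * t \<le> q - \<rho> + t - 1" unfolding M0_def by (rule le_div_iff[OF t(1)])
    then show ?thesis by (auto simp: algebra_simps)
  qed
  have "ternary_window p q t s N v (min p M0)"
  proof unfold_locales
    show "1 \<le> min p M0" using M0[of 0] rho p3 by auto
    show "min p M0 \<le> p" by simp
    fix m assume m: "0 \<le> m" "m < p"
    have mt: "0 \<le> m * t" "m * t \<le> t * p" using m t mult_right_mono[of m p t] by (auto simp: mult.commute)
    have "Z + m * t = (\<rho> + m * t) + q * (Z div q)" by (simp add: \<rho>_def)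
    moreover have "(\<rho> + m * t + q * (Z div q)) div q = Z div q + (\<rho> + m * t) div q"
      by (rule div_mult_self2) (use q_pos in simp)
    ultimately have "(Z + m * t) div q = Z div q + (\<rho> + m * t) div q" by metis
    moreover have "(\<rho> + m * t) div q = (if q - \<rho> \<le> m * t then 1 else 0)"
    proof (cases "q - \<rho> \<le> m * t")
      case True
      then have "(\<rho> + m * t - q) div q = 0"
        using rho mt t_mult_p t by (intro div_pos_pos_trivial) linarith+
      then show ?thesis using True div_add_self2[of q "\<rho> + m * t - q"] q_pos by simp
    next
      case False
      then have "(\<rho> + m * t) div q = 0" using rho mt by (intro div_pos_pos_trivial) linarith+
      then show ?thesis using False by simp
    qed
    moreover have "\<dots> = stair (min p M0) m" using M0[of m] m by (auto simp: stair_def)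
    ultimately show "(N + (q - t) * v + m * t) div q = (N + (q - t) * v) div q + stair (min p M0) m"
      by (simp add: Z_def)
  qed (use assms in auto)
  then show thesis by (rule that)
qed

text \<open>The first alternative comes from a column wrapping below 0, the second from one wrapping
  above pq, where s becomes p - s and the sign is reversed. For t = 1 the offset is too small to
  wrap upwards, hence 1 < t.\<close>

definition upper :: int where
  "upper = min s (p - s) +
    (if (2 * s > p \<and> p - s < t) \<or> (2 * s < p \<and> 1 < t \<and> s < p - t) then 1 else 0)"

definition lower :: int where
  "lower = - min s (p - s) -
    (if (2 * s > p \<and> p - s < p - t) \<or> (2 * s < p \<and> s < t) then 1 else 0)"

lemma kaplan_sum_bounds:
  assumes "0 \<le> N" "N \<le> p * q - q"
  shows "lower \<le> kaplan_sum p q s t N v" "kaplan_sum p q s t N v \<le> upper"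
proof -
  obtain M where "ternary_window p q t s N v M" using ex_window[OF assms] .
  then interpret ternary_window p q t s N v M .
  have small: "lower \<le> kaplan_sum p q s t N v \<and> kaplan_sum p q s t N v \<le> upper" if "\<bar>kaplan_sum p q s t N v\<bar> \<le> min s (p - s)"
    using that by (auto simp: lower_def upper_def)
  consider (low) e where "e \<in> {0..<p}" "G e + \<tau> e - 1 < 0"
    | (high) e where "e \<in> {0..<p}" "p * q \<le> G e + \<tau> e - 1"
    | (none) "\<And>m. m \<in> {0..<p} \<Longrightarrow> 0 \<le> G m + \<tau> m - 1 \<and> G m + \<tau> m - 1 < p * q"
    by force
  then have "lower \<le> kaplan_sum p q s t N v \<and> kaplan_sum p q s t N v \<le> upper"
  proof cases
    case low
    have "e < s"
    proof (rule ccontr)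
      assume "\<not> e < s"
      then have "\<tau> e = t * s" by (simp add: \<tau>_def)
      then show False using low G_range(1)[of e] t_mult_s t by linarith
    qed
    then have e: "0 \<le> e" "e < s" using low by auto
    define K where "K = (N - G e) div q"
    note wl = wrap_low[OF e low(2), folded K_def]
    show ?thesis
    proof (cases "0 \<le> K")
      case True
      show ?thesis
        using wrapped_sum_le[OF t s two_s M e True wl(3), of b] wrapped_sum_ge[OF t s two_s M e True wl(3), of b]
        unfolding wl(2)[OF True] upper_def lower_def by (auto split: if_splits)
    next
      case False
      then show ?thesis using wl(1) small by simp
    qed
  next
    case high
    have "\<not> e < s" using high G_range(2)[of e] t_mult_s t unfolding \<tau>_def by auto
    then have e: "s \<le> e" "e < p" and e': "0 \<le> e - s" "e - s < p - s" using high(1) by auto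
    define K where "K = (N - 1 - G' e) div q"
    have t1: "1 < t"
    proof (rule ccontr)
      assume "\<not> 1 < t"
      then have "t = 1" using t by simp
      moreover have "s = 1" using st s \<open>t = 1\<close> by simp
      ultimately have "t * s = 1" by simp
      moreover have "\<tau> e = t * s" using e by (simp add: \<tau>_def)
      ultimately show False using high G_range(2)[of e] by linarith
    qed
    have s': "0 < p - s" "p - s < p" "2 * (p - s) \<noteq> p" using s two_s by auto
    note wl = wrap_high[OF e high(2), folded K_def]
    show ?thesis
    proof (cases "0 \<le> K")
      case True
      show ?thesis
        using wrapped_sum_le[OF t s' M e' True wl(3), of b] wrapped_sum_ge[OF t s' M e' True wl(3), of b] t1 two_s
        unfolding wl(2)[OF True] upper_def lower_def by (auto split: if_splits)
    next
      case False
      then show ?thesis using wl(1) small by simp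
    qed
  next
    case none
    then show ?thesis using unwrapped_bound[of "{0..<p}"] small by (simp add: kaplan_sum_eq)
  qed
  then show "lower \<le> kaplan_sum p q s t N v" "kaplan_sum p q s t N v \<le> upper" by auto
qed

section \<open>Explicit truncations and residues attaining the bounds\<close>

lemma window_intro:
  assumes N: "0 \<le> N" "N \<le> p * q - q" and M: "1 \<le> M" "M \<le> p"
    and Z: "\<And>m. N + (q - t) * v + m * t = (m - M) * t + q * c"
  shows "ternary_window p q t s N v M" and "(N + (q - t) * v) div q = c - 1"
proof -
  \<comment> \<open>As |(m - M) * t| < q, the expression (m - M) * t + q * c crosses a multiple of q
    exactly at m = M.\<close>
  have d: "(N + (q - t) * v + m * t) div q = c - 1 + stair M m" if "0 \<le> m" "m < p" for m
  proof -
    have "\<bar>(m - M) * t\<bar> \<le> p * t" unfolding abs_mult using that M t by (intro mult_mono) auto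
    then have "\<bar>(m - M) * t\<bar> < q" using t_mult_p t by (simp add: mult.commute)
    moreover have "0 \<le> (m - M) * t \<longleftrightarrow> M \<le> m" using t by (auto simp: zero_le_mult_iff)
    ultimately have "((m - M) * t) div q = (if M \<le> m then 0 else - 1)"
      using div_pos_pos_trivial[of "(m - M) * t" q] div_minus_one[of "(m - M) * t"] by auto
    then show ?thesis unfolding Z using q_pos by (simp add: stair_def)
  qed
  from d[of 0] show "(N + (q - t) * v) div q = c - 1" using p3 M by (simp add: stair_def)
  then show "ternary_window p q t s N v M"
    by unfold_locales (use assms d in auto)
qed

lemma ex_wrap_low:
  assumes s2: "2 * s > p"
  obtains N v where "0 \<le> N" "N \<le> p * q - q"
    "kaplan_sum p q s t N v = wrapped_sum p t s (p - s) (s - 1) (p - s) b0"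
proof -
  \<comment> \<open>This only tunes b: subtracting q * e0 from v does not change
    \<open>G (s - 1)\<close>, as p divides q - t, while b becomes -(p - s) - t * e0, which is b0
    modulo p.\<close>
  define e0 where "e0 = - s * (p - s + b0)"
  \<comment> \<open>The multiple of q yields K = p - s; the remainder is (e - M) * t for e = s - 1
    and M = p - s, which places the carry at M.\<close>
  define N where "N = (p - s) * q + (2 * s - 1 - p) * t"
  define v where "v = s - 1 - q * e0"
  define c where "c = p - s + (s - 1) - q * e0 + t * e0"
  have et: "0 \<le> (2 * s - 1 - p) * t" "(2 * s - 1 - p) * t \<le> p * t"
    using s2 s t by (auto intro!: mult_right_mono)
  have ptq: "p * t < q" using t_mult_p t by (simp add: mult.commute)
  have "0 \<le> (p - s) * q" "(p - s) * q \<le> (p - 2) * q"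
    using s s2 p3 q_pos by (auto intro!: mult_right_mono)
  then have sq: "0 \<le> (p - s) * q" "(p - s) * q \<le> p * q - 2 * q" by (simp_all add: left_diff_distrib)
  have N: "0 \<le> N" "N \<le> p * q - q" using et sq ptq unfolding N_def by linarith+
  have Z: "N + (q - t) * v + m * t = (m - (p - s)) * t + q * c" for m
    by (simp add: N_def v_def c_def algebra_simps)
  have M: "1 \<le> p - s" "p - s \<le> p" using s by auto
  interpret ternary_window p q t s N v "p - s" by (rule window_intro(1)[OF N M Z])
  have Zdiv: "Z div q = c - 1" unfolding Z_def by (rule window_intro(2)[OF N M Z])
  have "p * q dvd (q - t) * (s - 1 - v)"
    using mult_dvd_mono[OF p_dvd(1), of q "q * e0"] by (simp add: v_def)
  then have G0: "G (s - 1) = 0" by (simp add: G_def)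
  have e: "0 \<le> s - 1" "s - 1 < s" using s by auto
  have wrap: "G (s - 1) + \<tau> (s - 1) - 1 < 0" using G0 t_mult_s t by (simp add: \<tau>_def)
  have K: "(N - G (s - 1)) div q = p - s"
    unfolding G0 N_def using et ptq q_pos div_pos_pos_trivial[of "(2 * s - 1 - p) * t" q] by simp
  have "t * s * x mod p = x mod p" for x by (metis mult.commute mod_mult_left_eq mult_1 st)
  then have "(- (p - s) + t * s * (p - s + b0)) mod p = b0 mod p"
    by (metis add.assoc add.left_inverse add_0 mod_add_right_eq)
  moreover have "v - c = - (p - s) + t * s * (p - s + b0)"
    by (simp add: v_def c_def e0_def algebra_simps)
  moreover have "b = v - c" by (simp add: b_def Zdiv)
  ultimately have "b mod p = b0 mod p" by simp
  then have "kaplan_sum p q s t N v = wrapped_sum p t s (p - s) (s - 1) (p - s) b0"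
    using wrap_low(2)[OF e wrap] s wrapped_sum_mod[of b p b0] unfolding K by simp
  then show thesis using that N by blast
qed

lemma ex_wrap_high:
  assumes s2: "2 * s < p" and t1: "1 < t" and r: "p * q dvd r * t - 1"
  obtains N v where "0 \<le> N" "N \<le> p * q - q"
    "kaplan_sum p q s t N v = - wrapped_sum p t (p - s) s (p - s - 1) s b0"
proof -
  obtain k where k: "r * t = 1 + p * q * k" using r by (metis add.commute diff_add_cancel dvdE)
  define e0 where "e0 = - s * (s + b0)"
  \<comment> \<open>The same recipe with p - s for s, displaced column p - 1 and M = K = s; the
    final 1 compensates the 1 in N - 1 - G' (p - 1).\<close>
  define N where "N = s * q + (p - 2 * s - 1) * t + 1"
  \<comment> \<open>The inverse r of t supplies the 1 that makes \<open>G' (p - 1)\<close> vanish: r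
    and s agree modulo p, so (q - t) * (s - r) reduces to r * t - t * s modulo pq.\<close>
  define v where "v = p - s - 1 + r - q * e0"
  define c where "c = s + (p - s - 1) + r - q * e0 + t * e0 - p * k"
  have et: "0 \<le> (p - 2 * s - 1) * t" "(p - 2 * s - 1) * t \<le> p * t"
    using s2 s t by (auto intro!: mult_right_mono)
  have ptq: "p * t + t < q" using t_mult_p by (simp add: mult.commute)
  have "0 \<le> s * q" "s * q \<le> (p - 2) * q"
    using s s2 p3 q_pos by (auto intro!: mult_right_mono)
  then have sq: "0 \<le> s * q" "s * q \<le> p * q - 2 * q" by (simp_all add: left_diff_distrib)
  have N: "0 \<le> N" "N \<le> p * q - q" using et sq ptq t unfolding N_def by linarith+
  have Z: "N + (q - t) * v + m * t = (m - s) * t + q * c" for m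
    using k by (simp add: N_def v_def c_def algebra_simps)
  have M: "1 \<le> s" "s \<le> p" using s by auto
  interpret ternary_window p q t s N v s by (rule window_intro(1)[OF N M Z])
  have Zdiv: "Z div q = c - 1" unfolding Z_def by (rule window_intro(2)[OF N M Z])
  have tsb: "2 \<le> t * s" "t * s < p * q"
  proof -
    show "2 \<le> t * s" using t1 t_mult_s by linarith
    have "q \<le> p * q" using p3 q_pos by simp
    then show "t * s < p * q" using t_mult_s t_mult_p t by linarith
  qed
  obtain h where h: "q - t = p * h" using p_dvd(1) by (elim dvdE)
  have "(q - t) * (p - 1 - v) = q * (s - r + (q - t) * e0) + (r * t - t * s)"
    by (simp add: v_def algebra_simps)
  also obtain g where g: "s - r = p * g"
  proof -
    have "p dvd (r * t - 1) - (t * s - 1)" using r p_dvd(2) by (blast intro: dvd_diff dvd_mult_left)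
    also have "(r * t - 1) - (t * s - 1) = (r - s) * t" by (simp add: algebra_simps)
    finally have "p dvd (r - s) * t" .
    moreover have "coprime p t" using p_dvd(2) by (metis coprime_iff_invertible_int cong_iff_dvd_diff mult.commute coprime_commute)
    ultimately have "p dvd s - r" by (metis coprime_dvd_mult_left_iff dvd_minus_iff minus_diff_eq)
    then show thesis using that by (elim dvdE)
  qed
  have "q * (s - r + (q - t) * e0) + (r * t - t * s) = p * q - t * s + 1 + p * q * (g + h * e0 + k - 1)"
    unfolding g h k by (simp add: algebra_simps)
  finally have eq: "(q - t) * (p - 1 - v) = p * q - t * s + 1 + p * q * (g + h * e0 + k - 1)" .
  have Ge: "G (p - 1) = p * q - t * s + 1"
    unfolding G_def eq mod_mult_self2 using tsb by (intro mod_pos_pos_trivial) auto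
  have e: "s \<le> p - 1" "p - 1 < p" using s by auto
  have te: "\<tau> (p - 1) = t * s" using e by (simp add: \<tau>_def)
  have wrap: "p * q \<le> G (p - 1) + \<tau> (p - 1) - 1" using Ge te by simp
  have G'0: "G' (p - 1) = 0" unfolding G'_def Ge te by simp
  have K: "(N - 1 - G' (p - 1)) div q = s"
  proof -
    have "(p - 2 * s - 1) * t < q" using et ptq t by linarith
    then have "(p - 2 * s - 1) * t div q = 0" using et by (intro div_pos_pos_trivial)
    then show ?thesis unfolding G'0 N_def using q_pos by simp
  qed
  have tsx: "t * s * x mod p = x mod p" for x by (metis mult.commute mod_mult_left_eq mult_1 st)
  have "b = v - c" by (simp add: b_def Zdiv)
  also have "v - c = - s + t * s * (s + b0) + p * k"
    by (simp add: v_def c_def e0_def algebra_simps)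
  finally have "b = - s + t * s * (s + b0) + p * k" .
  then have "b mod p = (- s + t * s * (s + b0)) mod p" by simp
  also have "\<dots> = b0 mod p" using tsx[of "s + b0"]
    by (metis add.assoc add.left_inverse add_0 mod_add_right_eq)
  finally have "b mod p = b0 mod p" .
  moreover have "p - 1 - s = p - s - 1" by simp
  ultimately have "kaplan_sum p q s t N v = - wrapped_sum p t (p - s) s (p - s - 1) s b0"
    using wrap_high(2)[OF e wrap] s wrapped_sum_mod[of b p b0] unfolding K by (simp add: algebra_simps)
  then show thesis using that N by blast
qed

text \<open>A wrap below 0 is extremal for 2s > p, a wrap above pq for 2s < p. The residues 0 and t
  chosen for b are the two jumps of the window; the minus sign of the upward wrap interchanges
  them.\<close>

lemma extremes_attained:
  assumes "1 < t" and r: "p * q dvd r * t - 1"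
  shows "\<exists>N v. 0 \<le> N \<and> kaplan_sum p q s t N v = upper"
    and "\<exists>N v. 0 \<le> N \<and> kaplan_sum p q s t N v = lower"
proof -
  have "2 * s > p \<or> 2 * s < p" using two_s by linarith
  then show "\<exists>N v. 0 \<le> N \<and> kaplan_sum p q s t N v = upper"
  proof
    assume s2: "2 * s > p"
    obtain N v where N: "0 \<le> N" and V: "kaplan_sum p q s t N v = wrapped_sum p t s (p - s) (s - 1) (p - s) 0"
      using ex_wrap_low[OF s2] .
    have "kaplan_sum p q s t N v = upper" unfolding V using wrapped_sum_extremal_0[OF t s(2) s2] s2 by (auto simp: upper_def)
    then show ?thesis using N by blast
  next
    assume s2: "2 * s < p"
    then have s2': "2 * (p - s) > p" "p - s < p" using s by auto
    obtain N v where N: "0 \<le> N" and V: "kaplan_sum p q s t N v = - wrapped_sum p t (p - s) s (p - s - 1) s t"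
      using ex_wrap_high[OF s2 assms] .
    have "kaplan_sum p q s t N v = upper" unfolding V using wrapped_sum_extremal_t[OF t s2'(2,1)] s2 assms by (auto simp: upper_def)
    then show ?thesis using N by blast
  qed
  have "2 * s > p \<or> 2 * s < p" using two_s by linarith
  then show "\<exists>N v. 0 \<le> N \<and> kaplan_sum p q s t N v = lower"
  proof
    assume s2: "2 * s > p"
    obtain N v where N: "0 \<le> N" and V: "kaplan_sum p q s t N v = wrapped_sum p t s (p - s) (s - 1) (p - s) t"
      using ex_wrap_low[OF s2] .
    have "kaplan_sum p q s t N v = lower" unfolding V using wrapped_sum_extremal_t[OF t s(2) s2] s2 by (auto simp: lower_def)
    then show ?thesis using N by blast
  next
    assume s2: "2 * s < p"
    then have s2': "2 * (p - s) > p" "p - s < p" using s by auto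
    obtain N v where N: "0 \<le> N" and V: "kaplan_sum p q s t N v = - wrapped_sum p t (p - s) s (p - s - 1) s 0"
      using ex_wrap_high[OF s2 assms] .
    have "kaplan_sum p q s t N v = lower" unfolding V using wrapped_sum_extremal_0[OF t s2'(2,1)] s2 assms by (auto simp: lower_def)
    then show ?thesis using N by blast
  qed
qed

end

section \<open>The polynomials\<close>

abbreviation X :: "nat \<Rightarrow> int poly" where "X \<equiv> monom 1"

text \<open>Multiplication by k permutes the residues modulo p, so the two sums agree modulo y^p -
  1, which is itself a multiple of the left one.\<close>

lemma geometric_dvd_power:
  fixes y :: "'a::comm_ring_1"
  assumes "coprime k p"
  shows "(\<Sum>i<p. y ^ i) dvd (\<Sum>i<p. (y ^ k) ^ i)"
proof (cases "p = 0")
  case False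
  have per: "y ^ p - 1 dvd y ^ (p * j) - 1" for j
    unfolding power_mult by (simp add: power_diff_1_eq)
  have "inj_on (\<lambda>i. k * i mod p) {..<p}"
  proof
    fix i j assume ij: "i \<in> {..<p}" "j \<in> {..<p}" "k * i mod p = k * j mod p"
    then have "[i = j] (mod p)" using assms by (simp add: cong_def[symmetric] cong_mult_lcancel_nat)
    then show "i = j" using ij by (simp add: cong_less_modulus_unique_nat)
  qed
  moreover have "(\<lambda>i. k * i mod p) ` {..<p} \<subseteq> {..<p}" using False by auto
  ultimately have "bij_betw (\<lambda>i. k * i mod p) {..<p} {..<p}"
    by (simp add: bij_betw_def endo_inj_surj)
  then have "(\<Sum>i<p. y ^ i) = (\<Sum>i<p. y ^ (k * i mod p))"
    by (rule sum.reindex_bij_betw[symmetric])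
  then have "(\<Sum>i<p. (y ^ k) ^ i) - (\<Sum>i<p. y ^ i) = (\<Sum>i<p. y ^ (k * i) - y ^ (k * i mod p))"
    by (simp add: sum_subtractf power_mult)
  also have "y ^ p - 1 dvd \<dots>"
  proof (rule dvd_sum)
    fix i
    have "k * i = k * i mod p + p * (k * i div p)" by simp
    then have "y ^ (k * i) - y ^ (k * i mod p) = y ^ (k * i mod p) * (y ^ (p * (k * i div p)) - 1)"
      by (metis power_add right_diff_distrib mult.right_neutral)
    then show "y ^ p - 1 dvd y ^ (k * i) - y ^ (k * i mod p)" using per by simp
  qed
  finally have "y ^ p - 1 dvd (\<Sum>i<p. (y ^ k) ^ i) - (\<Sum>i<p. y ^ i)" .
  moreover have "(\<Sum>i<p. y ^ i) dvd y ^ p - 1" by (simp add: power_diff_1_eq)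
  ultimately have "(\<Sum>i<p. y ^ i) dvd (\<Sum>i<p. (y ^ k) ^ i) - (\<Sum>i<p. y ^ i)" by (rule dvd_trans[rotated])
  from dvd_add[OF this dvd_refl] show ?thesis by simp
qed simp

text \<open>The semigroup elements from which p cannot be subtracted form the Apery set with respect
  to p, here the first p multiples of q.\<close>

lemma in_semigroup_diff:
  assumes "0 < p" "(s * q) mod p = 1 mod p"
  shows "in_semigroup p q s k - in_semigroup p q s (k - p) = (if \<exists>b\<in>{0..<p}. k = q * b then 1 else 0)"
proof -
  define y where "y = (k * s) mod p"
  have y: "0 \<le> y" "y < p" using assms by (auto simp: y_def)
  have y': "((k - p) * s) mod p = y" by (simp add: y_def left_diff_distrib mod_eq_dvd_iff)
  have qs: "p dvd s * q - 1" using assms by (simp add: mod_eq_dvd_iff)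
  have "p dvd k * s - y" by (simp add: y_def)
  then have "p dvd (k * s - y) * q - k * (s * q - 1)" using qs by (meson dvd_diff dvd_mult dvd_mult2)
  then have ky: "p dvd k - q * y" by (simp add: algebra_simps)
  have "(\<exists>b\<in>{0..<p}. k = q * b) \<longleftrightarrow> q * y \<le> k \<and> k - p < q * y"
  proof
    assume "q * y \<le> k \<and> k - p < q * y"
    then have "k - q * y = 0" using ky zdvd_not_zless[of "k - q * y" p] by (cases "0 < k - q * y") auto
    then show "\<exists>b\<in>{0..<p}. k = q * b" using y by auto
  next
    assume "\<exists>b\<in>{0..<p}. k = q * b"
    then obtain b where b: "b \<in> {0..<p}" "k = q * b" by blast
    have "y = (b * (s * q)) mod p" by (simp add: y_def b ac_simps)
    also have "\<dots> = b mod p" using assms(2) by (metis mod_mult_right_eq mult.right_neutral)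
    finally show "q * y \<le> k \<and> k - p < q * y" using b assms by simp
  qed
  then show ?thesis unfolding in_semigroup_def y' y_def[symmetric] using assms(1) by auto
qed

definition bin_poly :: "nat \<Rightarrow> nat \<Rightarrow> nat \<Rightarrow> int poly" where
  "bin_poly p q s = (\<Sum>k<p * q. monom (bin_coeff (int p) (int q) (int s) (int k)) k)"

lemma in_semigroup_neg: "0 < p \<Longrightarrow> 0 \<le> q \<Longrightarrow> k < 0 \<Longrightarrow> in_semigroup p q s k = 0"
proof -
  assume "0 < p" "0 \<le> q" "k < 0"
  then have "0 \<le> q * ((k * s) mod p)" by simp
  then have "\<not> q * ((k * s) mod p) \<le> k" using \<open>k < 0\<close> by linarith
  then show ?thesis by (simp add: in_semigroup_def)
qed

text \<open>From pq - q on every integer lies in the semigroup, so the differences vanish from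
  degree pq on and the finite sum loses nothing.\<close>

lemma coeff_bin_poly:
  assumes "0 < p" "0 < q"
  shows "coeff (bin_poly p q s) k = bin_coeff (int p) (int q) (int s) (int k)"
proof -
  have "bin_coeff (int p) (int q) (int s) (int k) = 0" if "p * q \<le> k"
  proof -
    have "int (p * q) \<le> int k" using that by (rule of_nat_mono)
    then have le: "int q * (y mod int p) \<le> int k - 1" for y
      using mult_mod_le[of "int p" "int q" y] assms by (simp add: mult.commute)
    have "int q * (y mod int p) \<le> int k" for y using le[of y] by linarith
    then show ?thesis using le by (simp add: bin_coeff_def in_semigroup_def)
  qed
  then show ?thesis by (auto simp: bin_poly_def coeff_sum)
qed

lemma geometric_X: "(X k - 1) * (\<Sum>i<p. X (k * i)) = X (k * p) - 1"
  using power_diff_1_eq[of "X k" p] by (simp add: monom_power mult.commute)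

lemma geometric_X_1: "(X 1 - 1) * (\<Sum>i<p. X i) = X p - 1"
  using geometric_X[of 1 p] by (simp del: One_nat_def)

text \<open>The polynomial is 1 - x times the generating function of the semigroup. Multiplying that
  function by 1 - x^p leaves the sum over the Apery set, a geometric sum in x^q.\<close>

lemma bin_poly_mult:
  assumes "0 < p" "0 < q" and sq: "[s * q = 1] (mod p)"
  shows "bin_poly p q s * (X p - 1) * (X q - 1) = (X 1 - 1) * (X (p * q) - 1)"
proof -
  have sq': "(int s * int q) mod int p = 1 mod int p"
    using sq by (metis cong_def of_nat_1 of_nat_mod of_nat_mult)
  define I where "I k = (if \<exists>b\<in>{0..<int p}. k = int q * b then 1 else 0 :: int)" for k
  have cS: "coeff (\<Sum>b<p. X (q * b)) n = I (int n)" for n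
  proof -
    have "coeff (\<Sum>b<p. X (q * b)) n = (\<Sum>b<p. if q * b = n then 1 else 0)" by (simp add: coeff_sum)
    also have "\<dots> = I (int n)"
    proof (cases "\<exists>b<p. n = q * b")
      case True
      then obtain b where b: "b < p" "n = q * b" by blast
      then have "(\<Sum>b<p. if q * b = n then 1 else 0 :: int) = (\<Sum>c<p. if c = b then 1 else 0)"
        using assms by (intro sum.cong) auto
      then show ?thesis using b by (auto simp: I_def intro!: bexI[of _ "int b"])
    next
      case False
      have "\<not> (\<exists>b\<in>{0..<int p}. int n = int q * b)"
      proof
        assume "\<exists>b\<in>{0..<int p}. int n = int q * b"
        then obtain b where "0 \<le> b" "b < int p" "int n = int q * b" by auto
        then have "n = q * nat b" "nat b < p" by (auto simp: nat_less_iff) (metis int_nat_eq of_nat_eq_iff of_nat_mult)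
        then show False using False by blast
      qed
      then show ?thesis using False by (auto simp: I_def intro!: sum.neutral)
    qed
    finally show ?thesis .
  qed
  have neg: "in_semigroup (int p) (int q) (int s) k = 0" if "k < 0" for k using assms that by (intro in_semigroup_neg) auto
  have rec: "in_semigroup (int p) (int q) (int s) k = in_semigroup (int p) (int q) (int s) (k - int p) + I k" for k
    using in_semigroup_diff[OF _ sq', of k] assms by (simp add: I_def)
  have "bin_poly p q s * (X p - 1) = (X 1 - 1) * (\<Sum>b<p. X (q * b))"
  proof (rule poly_eqI)
    fix n
    have "coeff (bin_poly p q s * (X p - 1)) n =
       (if p \<le> n then coeff (bin_poly p q s) (n - p) else 0) - coeff (bin_poly p q s) n"
      by (simp add: right_diff_distrib mult.commute[of _ "X p"] coeff_monom_mult)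
    also have "\<dots> = bin_coeff (int p) (int q) (int s) (int n - int p) - bin_coeff (int p) (int q) (int s) (int n)"
      using coeff_bin_poly[OF assms(1,2)] neg by (auto simp: bin_coeff_def of_nat_diff)
    also have "\<dots> = I (int n - 1) - I (int n)"
      using rec[of "int n"] rec[of "int n - 1"] by (simp add: bin_coeff_def algebra_simps)
    also have "\<dots> = (if 1 \<le> n then I (int (n - 1)) else 0) - I (int n)"
    proof -
      have "I (- 1) = 0" using rec[of "-1"] neg[of "-1"] neg[of "- 1 - int p"] by simp
      then show ?thesis by (auto simp: of_nat_diff not_le)
    qed
    also have "\<dots> = coeff ((X 1 - 1) * (\<Sum>b<p. X (q * b))) n"
      unfolding left_diff_distrib by (simp add: coeff_monom_mult cS del: One_nat_def)
    finally show "coeff (bin_poly p q s * (X p - 1)) n = coeff ((X 1 - 1) * (\<Sum>b<p. X (q * b))) n" .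
  qed
  then have "bin_poly p q s * (X p - 1) * (X q - 1) = (X 1 - 1) * ((X q - 1) * (\<Sum>b<p. X (q * b)))"
    by (simp only: ac_simps)
  then show ?thesis unfolding geometric_X by (simp only: mult.commute)
qed

lemma X_neq: "0 < k \<Longrightarrow> X k - 1 \<noteq> 0"
proof
  assume "0 < k" "X k - 1 = 0"
  moreover have "coeff (X k - 1) k = 1" using \<open>0 < k\<close> by simp
  ultimately show False by simp
qed

lemma pcompose_X: "pcompose (X k) (X r) = X (r * k)"
  by (induction k) (simp_all add: monom_Suc pcompose_pCons mult_monom pcompose_1)

lemma bin_poly_geometric:
  assumes "0 < p" "0 < q" "[s * q = 1] (mod p)"
  shows "bin_poly p q s * (\<Sum>i<p. X i) * (X q - 1) = X (p * q) - 1"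
proof -
  have "(X 1 - 1) * (bin_poly p q s * (\<Sum>i<p. X i) * (X q - 1)) = (X 1 - 1) * (X (p * q) - 1)"
  proof -
    have "(X 1 - 1) * (bin_poly p q s * (\<Sum>i<p. X i) * (X q - 1)) =
        bin_poly p q s * ((X 1 - 1) * (\<Sum>i<p. X i)) * (X q - 1)"
      by (simp only: ac_simps)
    then show ?thesis unfolding geometric_X_1 bin_poly_mult[OF assms] .
  qed
  then show ?thesis using X_neq[of 1] by (simp del: One_nat_def)
qed

lemma X_period: "X n - 1 dvd X (i + n * j) - X i"
proof -
  have "X (i + n * j) - X i = X i * (X (n * j) - 1)" by (simp add: right_diff_distrib mult_monom)
  then show ?thesis unfolding geometric_X[symmetric] by simp
qed

text \<open>Substituting x^r into the binary identity gives a multiple of x^pq - 1. The factors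
  other than the binary polynomial divide their analogues with r * u in place of r, and x^(ru) is x
  modulo x^pq - 1. Thus divisibility follows without roots of unity.\<close>

lemma ternary_dvd:
  assumes "0 < p" "0 < q" "[s * q = 1] (mod p)" and ru: "r * u = 1 + p * q * k"
  shows "X (p * q) - 1 dvd pcompose (bin_poly p q s) (X r) * (\<Sum>i<p. X i) * (X q - 1)"
proof -
  define C where "C = pcompose (bin_poly p q s) (X r)"
  define n where "n = p * q"
  have "coprime u p"
  proof (rule coprimeI)
    fix d assume "d dvd u" "d dvd p"
    then have "d dvd r * u" "d dvd p * q * k" by auto
    then show "is_unit d" unfolding ru by (metis dvd_add_left_iff)
  qed
  have "C * (\<Sum>i<p. X (r * i)) * (X (r * q) - 1) = X (r * n) - 1"
    using arg_cong[OF bin_poly_geometric[OF assms(1-3)], of "\<lambda>f. pcompose f (X r)"]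
    by (simp add: pcompose_mult pcompose_diff pcompose_sum pcompose_X C_def n_def pcompose_1)
  moreover have "X n - 1 dvd X (r * n) - 1" using X_period[of n 0 r] by (simp add: mult.commute)
  ultimately have "X n - 1 dvd C * (\<Sum>i<p. X (r * i)) * (X (r * q) - 1)" by simp
  moreover have "(\<Sum>i<p. X (r * i)) dvd (\<Sum>i<p. X (r * u * i))"
    using geometric_dvd_power[OF \<open>coprime u p\<close>, of "X r"] by (simp add: monom_power)
  moreover have "X (r * q) - 1 dvd X (r * u * q) - 1"
    using X_period[of "r * q" 0 u] by (simp add: ac_simps)
  ultimately have d: "X n - 1 dvd C * (\<Sum>i<p. X (r * u * i)) * (X (r * u * q) - 1)"
    by (meson dvd_trans mult_dvd_mono dvd_refl)
  have per: "X n - 1 dvd X (r * u * i) - X i" for i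
    using X_period[of n i "k * i"] by (simp add: ru n_def algebra_simps)
  have "X n - 1 dvd (\<Sum>i<p. X (r * u * i) - X i)" by (rule dvd_sum) (rule per)
  then have d1: "X n - 1 dvd (\<Sum>i<p. X (r * u * i)) - (\<Sum>i<p. X i)" by (simp add: sum_subtractf)
  have "C * (\<Sum>i<p. X (r * u * i)) * (X (r * u * q) - 1) - C * (\<Sum>i<p. X i) * (X q - 1) =
     C * ((\<Sum>i<p. X (r * u * i)) - (\<Sum>i<p. X i)) * (X (r * u * q) - 1) + C * (\<Sum>i<p. X i) * (X (r * u * q) - X q)"
    by (simp add: algebra_simps)
  also have "X n - 1 dvd \<dots>" using d1 per[of q] by (intro dvd_add) (auto intro: dvd_mult dvd_mult2)
  finally show ?thesis using dvd_diff[OF d] unfolding C_def n_def by fastforce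
qed

lemma ex_ternary_poly:
  assumes "0 < p" "0 < q" "0 < r" "[s * q = 1] (mod p)" "r * u = 1 + p * q * k"
  obtains P where "incl_excl_poly p q r = P"
    "P * (X (p * q) - 1) = pcompose (bin_poly p q s) (X r) * (\<Sum>i<p. X i) * (X q - 1)"
    "degree P + (p * q + q * r + r * p + 1) = p * q * r + p + q + r"
proof -
  define C where "C = pcompose (bin_poly p q s) (X r)"
  obtain P where P: "C * (\<Sum>i<p. X i) * (X q - 1) = (X (p * q) - 1) * P"
    using ternary_dvd[OF assms(1,2,4,5)] unfolding C_def by (elim dvdE)
  define D where "D = (X (p * q) - 1) * (X (q * r) - 1) * (X (r * p) - 1) * (X 1 - 1)"
  define E where "E = (X (p * q * r) - 1) * (X p - 1) * (X q - 1) * (X r - 1)"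
  have C: "C * (X (r * p) - 1) * (X (q * r) - 1) = (X r - 1) * (X (p * q * r) - 1)"
    using arg_cong[OF bin_poly_mult[OF assms(1,2,4)], of "\<lambda>f. pcompose f (X r)"]
    by (simp add: pcompose_mult pcompose_diff pcompose_sum pcompose_X C_def pcompose_1 ac_simps)
  have "P * D = (C * (\<Sum>i<p. X i) * (X q - 1)) * (X (q * r) - 1) * (X (r * p) - 1) * (X 1 - 1)"
    unfolding P D_def by (simp only: ac_simps)
  also have "\<dots> = (C * (X (r * p) - 1) * (X (q * r) - 1)) * ((X 1 - 1) * (\<Sum>i<p. X i)) * (X q - 1)"
    by (simp only: ac_simps)
  also have "\<dots> = E" unfolding C geometric_X_1 E_def by (simp only: ac_simps)
  finally have PD: "P * D = E" .
  have D0: "D \<noteq> 0" using assms X_neq unfolding D_def by simp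
  have E0: "E \<noteq> 0" using assms X_neq unfolding E_def by simp
  have deg: "degree (X k - 1) = k" if "0 < k" for k
  proof -
    have "degree (X k + - 1) = degree (X k)" using that by (intro degree_add_eq_left) (simp add: degree_monom_eq)
    then show ?thesis by (simp add: degree_monom_eq)
  qed
  have "degree P + degree D = degree E" using PD D0 E0 by (metis degree_mult_eq mult_eq_0_iff)
  moreover have "degree D = p * q + q * r + r * p + 1"
    unfolding D_def using assms X_neq by (simp add: degree_mult_eq deg)
  moreover have "degree E = p * q * r + p + q + r"
    unfolding E_def using assms X_neq by (simp add: degree_mult_eq deg)
  moreover have "incl_excl_poly p q r = P"
    unfolding incl_excl_poly_def D_def[symmetric] E_def[symmetric] PD[symmetric] using D0 by simp
  ultimately show thesis using that P unfolding C_def by (simp add: mult.commute)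
qed

section \<open>Kaplan's formula\<close>

lemma kaplan_sum_cong:
  assumes "[u = u'] (mod p * q)" "[v = v'] (mod p * q)"
  shows "kaplan_sum p q s u N v = kaplan_sum p q s u' N v'"
proof -
  have "((v - i) * u) mod (p * q) = ((v' - i) * u') mod (p * q)"
    "((v - i - q) * u) mod (p * q) = ((v' - i - q) * u') mod (p * q)" for i
    using assms unfolding cong_def[symmetric] by (auto intro!: cong_mult cong_diff)
  then show ?thesis by (simp add: kaplan_sum_def)
qed

text \<open>Replacing r by r' negates u modulo pq; the substitution below exchanges the
  two halves of the sum.\<close>

lemma kaplan_sum_uminus:
  "kaplan_sum p q s (- u) N (q + p - 1 - v) = - kaplan_sum p q s u N v"
proof -
  have "kaplan_sum p q s (- u) N (q + p - 1 - v) =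
    (\<Sum>i\<in>{0..<p}. trunc_coeff p q s N (((v - i - q) * u) mod (p * q)) -
      trunc_coeff p q s N (((v - i) * u) mod (p * q)))"
    unfolding kaplan_sum_def
    by (rule sum.reindex_bij_witness[of _ "\<lambda>i. p - 1 - i" "\<lambda>i. p - 1 - i"]) (auto simp: algebra_simps)
  also have "\<dots> = - kaplan_sum p q s u N v"
    unfolding kaplan_sum_def by (simp add: sum_negf[symmetric])
  finally show ?thesis .
qed

locale ternary_poly =
  fixes p q r s :: nat and u :: int
  assumes p3: "3 \<le> p" and pq: "p < q" and sq: "[s * q = 1] (mod p)"
    and ru: "[int r * u = 1] (mod int p * int q)" and r_large: "p + q \<le> r"
begin

abbreviation "ksum \<equiv> kaplan_sum (int p) (int q) (int s) u"
abbreviation "c k \<equiv> bin_coeff (int p) (int q) (int s) (int k)"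
abbreviation "poly_T \<equiv> incl_excl_poly p q r"

lemma pq_bound: "p + q \<le> p * q" "0 < p" "0 < q" "0 < r"
proof -
  have "3 * q \<le> p * q" using p3 by (rule mult_right_mono) simp
  then show "p + q \<le> p * q" using pq by linarith
qed (use p3 pq r_large in auto)

text \<open>The inverse u may be negative (it is -t for r'), but the divisibility argument uses it
  as an exponent.\<close>

lemma ex_u: "\<exists>u' k. r * u' = 1 + p * q * k \<and> [u = int u'] (mod int p * int q)"
proof -
  define u' where "u' = nat (u mod (int p * int q))"
  have n: "0 < int p * int q" using pq_bound by simp
  then have u': "int u' = u mod (int p * int q)" by (simp add: u'_def)
  have "[int (r * u') = int 1] (mod int (p * q))"
    using ru by (simp add: u' cong_def mod_mult_right_eq)
  then have cg: "[r * u' = 1] (mod (p * q))" by (simp only: cong_int_iff)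
  have "1 < p * q" using pq_bound p3 by linarith
  have "r * u' \<noteq> 0"
  proof
    assume "r * u' = 0"
    then have "0 mod (p * q) = 1 mod (p * q)" using cg by (metis cong_def)
    then show False using \<open>1 < p * q\<close> by simp
  qed
  then have "p * q dvd r * u' - 1" using cg by (subst (asm) cong_altdef_nat) auto
  then obtain k where "r * u' - 1 = p * q * k" by (elim dvdE)
  then have "r * u' = 1 + p * q * k" using \<open>r * u' \<noteq> 0\<close> by linarith
  moreover have "[u = int u'] (mod int p * int q)" by (simp add: u' cong_def)
  ultimately show ?thesis by blast
qed

lemma poly_T:
  shows poly_T_mult: "poly_T * (X (p * q) - 1) = pcompose (bin_poly p q s) (X r) * (\<Sum>i<p. X i) * (X q - 1)"
    and coeff_T_0: "(p - 1) * (q - 1) * (r - 1) < n \<Longrightarrow> coeff poly_T n = 0"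
proof -
  obtain u' k where ru': "r * u' = 1 + p * q * k" using ex_u by blast
  obtain P where P: "poly_T = P"
    "P * (X (p * q) - 1) = pcompose (bin_poly p q s) (X r) * (\<Sum>i<p. X i) * (X q - 1)"
    "degree P + (p * q + q * r + r * p + 1) = p * q * r + p + q + r"
    using ex_ternary_poly[OF pq_bound(2,3,4) sq ru'] .
  show "poly_T * (X (p * q) - 1) = pcompose (bin_poly p q s) (X r) * (\<Sum>i<p. X i) * (X q - 1)"
    using P by simp
  obtain a b d where "p = Suc a" "q = Suc b" "r = Suc d"
    using pq_bound by (metis gr0_implies_Suc)
  then have "degree P = (p - 1) * (q - 1) * (r - 1)" using P(3) by (simp add: algebra_simps)
  then show "(p - 1) * (q - 1) * (r - 1) < n \<Longrightarrow> coeff poly_T n = 0"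
    using P(1) by (simp add: coeff_eq_0)
qed

text \<open>The coefficient of x^n in the power series x^j B(x^r) / (1 - x^pq), where B is the
  binary polynomial.\<close>

definition part_coeff :: "nat \<Rightarrow> nat \<Rightarrow> int" where
  "part_coeff n j = (\<Sum>k<p * q. c k * (if r * k + j \<le> n \<and> [r * k + j = n] (mod (p * q)) then 1 else 0))"

lemma pcompose_bin_poly: "pcompose (bin_poly p q s) (X r) = (\<Sum>k<p * q. monom (c k) (r * k))"
proof -
  have "pcompose (monom a k) (X r) = monom a (r * k)" for a k
    using arg_cong[OF pcompose_X[of k r], of "smult a"]
    by (simp add: pcompose_smult[symmetric] smult_monom)
  then show ?thesis by (simp add: bin_poly_def pcompose_sum)
qed

lemma coeff_T_rec:
  "coeff poly_T n = (if p * q \<le> n then coeff poly_T (n - p * q) else 0) +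
     (\<Sum>i<p. \<Sum>k<p * q. c k * ((if r * k + i = n then 1 else 0) - (if r * k + (i + q) = n then 1 else 0)))"
proof -
  have "pcompose (bin_poly p q s) (X r) * (\<Sum>i<p. X i) * (X q - 1) =
      (\<Sum>i<p. \<Sum>k<p * q. monom (c k) (r * k + (i + q)) - monom (c k) (r * k + i))"
  proof -
    have "pcompose (bin_poly p q s) (X r) * (\<Sum>i<p. X i) = (\<Sum>i<p. \<Sum>k<p * q. monom (c k) (r * k + i))"
      unfolding pcompose_bin_poly mult.commute[of _ "\<Sum>i<p. X i"] sum_product
      by (simp add: mult_monom add.commute)
    then show ?thesis
      by (simp add: right_diff_distrib sum_distrib_right sum_subtractf mult_monom add.assoc)
  qed
  then have "coeff (poly_T * (X (p * q) - 1)) n =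
     - (\<Sum>i<p. \<Sum>k<p * q. c k * ((if r * k + i = n then 1 else 0) - (if r * k + (i + q) = n then 1 else 0)))"
    unfolding poly_T_mult by (simp add: coeff_sum sum_negf[symmetric]) (intro sum.cong refl, auto)
  moreover have "coeff (poly_T * (X (p * q) - 1)) n = (if p * q \<le> n then coeff poly_T (n - p * q) else 0) - coeff poly_T n"
    by (simp add: right_diff_distrib mult.commute[of _ "X (p * q)"] coeff_monom_mult)
  ultimately show ?thesis by linarith
qed

lemma part_coeff_rec:
  "part_coeff n j = (if p * q \<le> n then part_coeff (n - p * q) j else 0) + (\<Sum>k<p * q. c k * (if r * k + j = n then 1 else 0))"
proof -
  have a: "(if x \<le> n \<and> [x = n] (mod (p * q)) then 1 else 0) =
     (if p * q \<le> n \<and> x \<le> n - p * q \<and> [x = n - p * q] (mod (p * q)) then 1 else 0) +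
     (if x = n then 1 else 0 :: int)" for x
  proof (cases "p * q \<le> n")
    case True
    then have "[n - p * q = n] (mod (p * q))" by (simp add: cong_def le_mod_geq)
    then have "[x = n - p * q] (mod (p * q)) \<longleftrightarrow> [x = n] (mod (p * q))" by (metis cong_sym cong_trans)
    moreover have "x \<le> n - p * q" if "x < n" "[x = n] (mod (p * q))"
    proof -
      have "p * q dvd n - x" using that by (metis cong_altdef_nat cong_sym less_imp_le)
      then have "p * q \<le> n - x" using that by (intro dvd_imp_le) auto
      then show ?thesis using that by linarith
    qed
    ultimately show ?thesis using True pq_bound by (auto simp: le_less)
  next
    case False
    then have "x \<le> n \<and> [x = n] (mod (p * q)) \<longleftrightarrow> x = n"
      by (auto simp: cong_def)
    then show ?thesis using False by simp
  qed
  show ?thesis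
    unfolding part_coeff_def a distrib_left sum.distrib by (auto simp: intro!: sum.cong)
qed

lemma coeff_T_eq_parts: "coeff poly_T n = (\<Sum>i<p. part_coeff n i - part_coeff n (i + q))"
proof (induction n rule: less_induct)
  case (less n)
  have IH: "(if p * q \<le> n then coeff poly_T (n - p * q) else 0) =
      (\<Sum>i<p. (if p * q \<le> n then part_coeff (n - p * q) i else 0) - (if p * q \<le> n then part_coeff (n - p * q) (i + q) else 0))"
    using less[of "n - p * q"] pq_bound by auto
  show ?case
    unfolding coeff_T_rec[of n] IH part_coeff_rec[of n] right_diff_distrib
    by (simp only: sum.distrib[symmetric] sum_subtractf[symmetric]) (simp add: sum_subtractf sum.distrib algebra_simps)
qed

lemma part_coeff_eq:
  assumes j: "j < p * q"
  shows "part_coeff n j = trunc_coeff (int p) (int q) (int s) (int (n div r)) (((int n - int j) * u) mod (int p * int q))"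
proof -
  define k0 where "k0 = nat (((int n - int j) * u) mod (int p * int q))"
  have npos: "0 < int p * int q" using pq_bound by simp
  have k0: "int k0 = ((int n - int j) * u) mod (int p * int q)" using npos by (simp add: k0_def)
  have k0l: "k0 < p * q"
  proof -
    have "int k0 < int (p * q)" unfolding k0 using npos by simp
    then show ?thesis by (simp only: of_nat_less_iff)
  qed
  have cg: "[r * k + j = n] (mod (p * q)) \<longleftrightarrow> k = k0" if k: "k < p * q" for k
  proof
    assume "[r * k + j = n] (mod (p * q))"
    then have "[int r * int k + int j = int n] (mod int p * int q)"
      by (metis cong_int_iff of_nat_add of_nat_mult)
    then have "[int r * int k = int n - int j] (mod int p * int q)"
      by (simp add: cong_iff_dvd_diff algebra_simps)
    then have "[int r * int k * u = (int n - int j) * u] (mod int p * int q)" by (rule cong_scalar_right)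
    moreover have "[int k * (int r * u) = int k * 1] (mod int p * int q)" using ru by (rule cong_scalar_left)
    ultimately have "[int k = (int n - int j) * u] (mod int p * int q)"
      by (metis cong_sym cong_trans mult.assoc mult.commute mult.right_neutral)
    then have "int k mod (int p * int q) = int k0" by (simp add: k0 cong_def)
    moreover have "int k < int p * int q" using k by (metis of_nat_less_iff of_nat_mult)
    ultimately show "k = k0" by simp
  next
    assume "k = k0"
    have "[int k0 = (int n - int j) * u] (mod int p * int q)" by (simp add: k0 cong_def)
    then have "[int r * int k0 = int r * ((int n - int j) * u)] (mod int p * int q)" by (rule cong_scalar_left)
    moreover have "[(int n - int j) * (int r * u) = (int n - int j) * 1] (mod int p * int q)"
      using ru by (rule cong_scalar_left)
    ultimately have "[int r * int k0 = int n - int j] (mod int p * int q)"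
      by (metis cong_trans mult.left_commute mult.right_neutral)
    then have "[int (r * k0 + j) = int n] (mod int (p * q))"
      by (simp add: cong_iff_dvd_diff algebra_simps)
    then show "[r * k + j = n] (mod (p * q))" using \<open>k = k0\<close> by (simp only: cong_int_iff)
  qed
  have le: "r * k0 + j \<le> n \<longleftrightarrow> int k0 \<le> int (n div r)"
  proof -
    have "k0 \<le> n div r \<longleftrightarrow> r * k0 \<le> n"
      using less_eq_div_iff_mult_less_eq[OF pq_bound(4), of k0 n] by (simp add: mult.commute)
    moreover have "r * k0 + j \<le> n" if "r * k0 \<le> n"
    proof (rule ccontr)
      assume nle: "\<not> r * k0 + j \<le> n"
      then have "p * q dvd r * k0 + j - n"
        using cg[OF k0l] by (simp add: cong_altdef_nat)
      then have "p * q \<le> r * k0 + j - n" using nle by (intro dvd_imp_le) auto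
      then show False using that j by linarith
    qed
    ultimately show ?thesis by auto
  qed
  have "part_coeff n j = (\<Sum>k<p * q. if k = k0 then (if r * k0 + j \<le> n then c k0 else 0) else 0)"
    unfolding part_coeff_def using cg by (intro sum.cong) auto
  also have "\<dots> = (if r * k0 + j \<le> n then c k0 else 0)" using k0l by simp
  finally show ?thesis unfolding k0[symmetric] trunc_coeff_def le .
qed

lemma coeff_T: "coeff poly_T n = ksum (int (n div r)) (int n)"
proof -
  have "coeff poly_T n = (\<Sum>i<p.
     trunc_coeff (int p) (int q) (int s) (int (n div r)) (((int n - int i) * u) mod (int p * int q)) -
     trunc_coeff (int p) (int q) (int s) (int (n div r)) (((int n - int i - int q) * u) mod (int p * int q)))"
    unfolding coeff_T_eq_parts
  proof (rule sum.cong[OF refl])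
    fix i assume "i \<in> {..<p}"
    then have "i < p * q" "i + q < p * q" using pq_bound by auto
    then show "part_coeff n i - part_coeff n (i + q) = trunc_coeff (int p) (int q) (int s) (int (n div r)) (((int n - int i) * u) mod (int p * int q)) -
     trunc_coeff (int p) (int q) (int s) (int (n div r)) (((int n - int i - int q) * u) mod (int p * int q))"
      by (simp add: part_coeff_eq diff_diff_eq)
  qed
  also have "\<dots> = ksum (int (n div r)) (int n)"
    unfolding kaplan_sum_def
    by (rule sum.reindex_bij_witness[of _ nat int]) auto
  finally show ?thesis .
qed

section \<open>Realising every pair of truncation and residue by a coefficient\<close>

lemma dvd_mult_u: "int p * int q dvd x * u \<longleftrightarrow> int p * int q dvd x"
proof
  assume "int p * int q dvd x * u"
  then have "int p * int q dvd x * u * int r" by simp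
  moreover have "int p * int q dvd x * (int r * u - 1)" using ru by (simp add: cong_iff_dvd_diff)
  ultimately have "int p * int q dvd x * u * int r - x * (int r * u - 1)" by (rule dvd_diff)
  then show "int p * int q dvd x" by (simp add: algebra_simps)
qed simp

lemma trunc_coeff_0:
  "trunc_coeff (int p) (int q) (int s) 0 ((x * u) mod (int p * int q)) = (if int p * int q dvd x then 1 else 0)"
proof -
  define f where "f = (x * u) mod (int p * int q)"
  have f: "0 \<le> f" using pq_bound by (simp add: f_def)
  have "f = 0 \<longleftrightarrow> int p * int q dvd x" unfolding f_def using dvd_mult_u by (simp add: dvd_eq_mod_eq_0)
  moreover have "bin_coeff (int p) (int q) (int s) 0 = 1"
    using in_semigroup_neg[of "int p" "int q" "-1" "int s"] pq_bound by (simp add: bin_coeff_def in_semigroup_def)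
  ultimately show ?thesis unfolding f_def[symmetric] trunc_coeff_def using f by auto
qed

lemma dvd_small_iff: "\<bar>x\<bar> < int p * int q \<Longrightarrow> int p * int q dvd x \<longleftrightarrow> x = 0"
  using zdvd_not_zless[of "\<bar>x\<bar>" "int p * int q"] by auto

text \<open>These degrees are below r, so the truncation is 0 and only the index 0 counts. The value
  0 accounts for degrees beyond the range; 1 and -1 settle the case t = 1.\<close>

lemma small_coeffs: "coeff poly_T 0 = 1" "coeff poly_T p = 0" "coeff poly_T q = -1"
proof -
  have pq': "int p + int q \<le> int p * int q" using pq_bound(1) by (metis of_nat_add of_nat_le_iff of_nat_mult)
  have d: "0 div r = 0" "p div r = 0" "q div r = 0" using r_large p3 pq by auto
  have ksum_0: "ksum 0 v = (\<Sum>i\<in>{0..<int p}. (if v = i then 1 else 0) - (if v = i + int q then 1 else 0))"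
    if "0 \<le> v" "v \<le> int q" for v
    unfolding kaplan_sum_def trunc_coeff_0
  proof (rule sum.cong[OF refl])
    fix i assume "i \<in> {0..<int p}"
    then have "\<bar>v - i\<bar> < int p * int q" "\<bar>v - i - int q\<bar> < int p * int q"
      using that pq' pq by auto
    then have "int p * int q dvd v - i \<longleftrightarrow> v - i = 0" "int p * int q dvd v - i - int q \<longleftrightarrow> v - i - int q = 0"
      by (simp_all only: dvd_small_iff)
    then show "(if int p * int q dvd v - i then 1 else 0) - (if int p * int q dvd v - i - int q then 1 else 0) =
        (if v = i then 1 else 0) - (if v = i + int q then 1 else 0 :: int)"
      by (auto simp: algebra_simps)
  qed
  have p0: "0 < int p" "0 < int q" "int p < int q" using pq_bound pq by auto
  have "ksum 0 0 = (\<Sum>i\<in>{0..<int p}. if i = 0 then 1 else 0)"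
    using p0 by (subst ksum_0) (auto intro!: sum.cong)
  then show "coeff poly_T 0 = 1" using p0 unfolding coeff_T d by simp
  have "ksum 0 (int p) = (\<Sum>i\<in>{0..<int p}. 0)"
    using p0 by (subst ksum_0) (auto intro!: sum.neutral)
  then show "coeff poly_T p = 0" unfolding coeff_T d by simp
  have "ksum 0 (int q) = - (\<Sum>i\<in>{0..<int p}. if i = 0 then 1 else 0)"
    using p0 unfolding sum_negf[symmetric] by (subst ksum_0) (auto intro!: sum.cong)
  then show "coeff poly_T q = -1" using p0 unfolding coeff_T d by simp
qed

text \<open>Kaplan's reduction: unless N occurs among the indices in the sum, truncating at N is the
  same as truncating at N - 1.\<close>

lemma ksum_in_range: "ksum (int N) v \<in> range (coeff poly_T)"
proof -
  have step: "ksum (int N) v \<in> range (coeff poly_T) \<or> ksum (int N) v = ksum (int N - 1) v" for N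
  proof -
    \<comment> \<open>If j < r, then n = r * N + j is congruent to v and has n div r = N, so the
      value is a coefficient. Otherwise j >= p + q, whereas N can occur as an index only when j < p
      + q.\<close>
    define j where "j = (v - int r * int N) mod (int p * int q)"
    have j: "0 \<le> j" using pq_bound by (simp add: j_def)
    have jv: "[j + int r * int N = v] (mod int p * int q)"
      unfolding j_def cong_def by (simp add: mod_add_left_eq)
    show ?thesis
    proof (cases "j < int r")
      case True
      define n where "n = r * N + nat j"
      have "n div r = N" using True j by (simp add: n_def nat_less_iff)
      moreover have "int n = j + int r * int N" using j by (simp add: n_def)
      ultimately have "coeff poly_T n = ksum (int N) v"
        unfolding coeff_T using jv by (simp add: kaplan_sum_cong[OF cong_refl])
      then show ?thesis by (metis rangeI)
    next
      case False
      have ne: "((v - i) * u) mod (int p * int q) \<noteq> int N" if i: "0 \<le> i" "i < int (p + q)" for i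
      proof
        assume "((v - i) * u) mod (int p * int q) = int N"
        then have "[(v - i) * u = int N] (mod int p * int q)" by (metis cong_def mod_mod_trivial)
        then have "[int r * ((v - i) * u) = int r * int N] (mod int p * int q)" by (rule cong_scalar_left)
        moreover have "[(v - i) * (int r * u) = (v - i) * 1] (mod int p * int q)" using ru by (rule cong_scalar_left)
        ultimately have "[int r * int N = v - i] (mod int p * int q)"
          by (metis cong_sym cong_trans mult.left_commute mult.right_neutral)
        then have "[v - int r * int N = v - (v - i)] (mod int p * int q)" by (intro cong_diff cong_refl)
        then have "j = i mod (int p * int q)" by (simp add: j_def cong_def)
        also have "\<dots> = i"
        proof -
          have "int (p + q) \<le> int (p * q)" using pq_bound(1) by (simp only: of_nat_le_iff)
          then show ?thesis using i by (intro mod_pos_pos_trivial) auto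
        qed
        finally show False using False i r_large by simp
      qed
      have tr: "trunc_coeff (int p) (int q) (int s) (int N) f = trunc_coeff (int p) (int q) (int s) (int N - 1) f"
        if "f \<noteq> int N" for f
        using that by (auto simp: trunc_coeff_def)
      have "ksum (int N) v = ksum (int N - 1) v"
        unfolding kaplan_sum_def
      proof (rule sum.cong[OF refl])
        fix i assume i: "i \<in> {0..<int p}"
        show "trunc_coeff (int p) (int q) (int s) (int N) ((v - i) * u mod (int p * int q)) -
           trunc_coeff (int p) (int q) (int s) (int N) ((v - i - int q) * u mod (int p * int q)) =
           trunc_coeff (int p) (int q) (int s) (int N - 1) ((v - i) * u mod (int p * int q)) -
           trunc_coeff (int p) (int q) (int s) (int N - 1) ((v - i - int q) * u mod (int p * int q))"
          using tr[OF ne[of i]] tr[OF ne[of "i + int q"]] i by (simp add: diff_diff_eq)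
      qed
      then show ?thesis ..
    qed
  qed
  show ?thesis
  proof (induction N)
    case 0
    \<comment> \<open>Truncating at -1 leaves the value 0, which is a coefficient, namely that of
      x^p.\<close>
    have "\<not> x mod (int p * int q) \<le> - 1" for x
    proof -
      have "0 \<le> x mod (int p * int q)" using pq_bound by (intro pos_mod_sign) simp
      then show ?thesis by linarith
    qed
    then have "ksum (- 1) v = 0" unfolding kaplan_sum_def trunc_coeff_def by simp
    then have "ksum (int 0 - 1) v = coeff poly_T p" using small_coeffs(2) by simp
    then show ?case using step[of 0] by (metis rangeI)
  next
    case (Suc N)
    then show ?case using step[of "Suc N"] by auto
  qed
qed

lemma coeff_set_eq: "coeff_set p q r = {ksum N v | N v. 0 \<le> N}"
proof -
  \<comment> \<open>Degree p is within the range, so the zeros beyond the range add no new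
    value.\<close>
  have "p \<le> (p - 1) * (q - 1) * (r - 1)"
  proof -
    have "p \<le> q - 1" "1 \<le> p - 1" "1 \<le> r - 1" using p3 pq r_large by auto
    then have "1 * p * 1 \<le> (p - 1) * (q - 1) * (r - 1)" by (intro mult_le_mono)
    then show ?thesis by simp
  qed
  then have "coeff_set p q r = range (coeff poly_T)"
    unfolding coeff_set_def using coeff_T_0 small_coeffs(2) by (auto simp: not_le) (metis not_le)
  also have "\<dots> = {ksum N v | N v. 0 \<le> N}"
  proof (intro equalityI subsetI)
    fix x assume "x \<in> range (coeff poly_T)"
    then show "x \<in> {ksum N v | N v. 0 \<le> N}" using coeff_T by fastforce
  next
    fix x assume "x \<in> {ksum N v | N v. 0 \<le> N}"
    then obtain N v where "x = ksum N v" "0 \<le> N" by blast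
    then show "x \<in> range (coeff poly_T)" using ksum_in_range[of "nat N" v] by simp
  qed
  finally show ?thesis .
qed

text \<open>Every N >= 0 yields coefficients, but the bounds on Kaplan sums are proved for N <= pq -
  q; the degree bound provides a representation of that kind.\<close>

lemma coeff_set_small:
  assumes "x \<in> coeff_set p q r"
  obtains N v where "x = ksum N v" "0 \<le> N" "N \<le> int p * int q - int q"
proof -
  obtain m where m: "x = coeff poly_T m" "m \<le> (p - 1) * (q - 1) * (r - 1)"
    using assms by (auto simp: coeff_set_def)
  have "(p - 1) * (q - 1) * (r - 1) \<le> ((p - 1) * q) * r" by (intro mult_le_mono) auto
  then have "m div r \<le> (p - 1) * q" using m(2) pq_bound(4) by (metis div_le_mono div_mult_self_is_m le_trans)
  moreover have "int ((p - 1) * q) = int p * int q - int q"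
    using p3 by (simp add: of_nat_diff left_diff_distrib)
  ultimately have "int (m div r) \<le> int p * int q - int q" by (metis of_nat_le_iff)
  then show thesis using that m(1) coeff_T[of m] by (meson of_nat_0_le_iff)
qed

end

section \<open>Size of r and r', and assembly of the result\<close>

lemma ternary_r_large:
  fixes p q r t :: nat
  assumes "3 \<le> p" "p\<^sup>2 < q" "t < p" "p * q \<le> r * t + 1"
  shows "p + q \<le> r"
proof (rule ccontr)
  assume "\<not> p + q \<le> r"
  then have "r * t \<le> (p + q - 1) * (p - 1)" using assms by (intro mult_mono) auto
  \<comment> \<open>The right-hand side equals pq + p^2 - 2p + 2 - q, which is below pq because q >
    p^2.\<close>
  then have "p * q \<le> (p + q - 1) * (p - 1) + 1" using assms by linarith
  moreover obtain a where "p = a + 3" using assms(1) by (metis add.commute le_Suc_ex)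
  ultimately show False using assms(2) by (simp add: power2_eq_square algebra_simps)
qed

lemma Max_Min_eqI:
  fixes S :: "int set"
  assumes "\<And>x. x \<in> S \<Longrightarrow> l \<le> x \<and> x \<le> h" "l \<in> S" "h \<in> S" "l \<le> 0" "0 \<le> h"
  shows "Min S = l" "Max S = h" "Max (abs ` S) = max h (- l)"
proof -
  have fin: "finite S" by (rule finite_subset[of _ "{l..h}"]) (use assms(1) in auto)
  show "Min S = l" "Max S = h" using assms fin by (auto intro!: Min_eqI Max_eqI)
  show "Max (abs ` S) = max h (- l)"
  proof (rule Max_eqI)
    show "\<And>y. y \<in> abs ` S \<Longrightarrow> y \<le> max h (- l)" using assms(1) by fastforce
    have "h = \<bar>h\<bar>" "- l = \<bar>l\<bar>" using assms by auto
    then show "max h (- l) \<in> abs ` S" using assms(2,3) unfolding max_def by (metis imageI)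
  qed (use fin in simp)
qed

theorem theorem3:
  fixes p q r r' t s t\<^sub>0 s\<^sub>0 :: nat
  assumes "p \<ge> 3"
    and "t \<in> {1..p - 1}" and "coprime t p"
    and "s \<in> {1..p - 1}" and "[s * t = 1] (mod p)"
    and "t\<^sub>0 = min t (p - t)" and "s\<^sub>0 = min s (p - s)"
    and "r > q" and "r' > q" and "q > p\<^sup>2"
    and "[q = t] (mod p)"
    and "[r * t = 1] (mod (p * q))"
    and "[int r' * int t = -1] (mod (int p * int q))"
  shows "coeff_set p q r' = uminus ` coeff_set p q r \<and>
    (t = 1 \<and> s = 1 \<longrightarrow>
       min_coeff p q r = -1 \<and> max_coeff p q r = 1 \<and> height p q r = 1) \<and>
    (t > 1 \<and> s\<^sub>0 < t\<^sub>0 \<longrightarrow>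
       min_coeff p q r = - int s\<^sub>0 - 1 \<and> max_coeff p q r = int s\<^sub>0 + 1 \<and>
       height p q r = int s\<^sub>0 + 1) \<and>
    (t > 1 \<and> s\<^sub>0 \<ge> t\<^sub>0 \<and> ((t\<^sub>0, s\<^sub>0) = (t, s) \<or> (t\<^sub>0, s\<^sub>0) = (p - t, p - s)) \<longrightarrow>
       min_coeff p q r = - int s\<^sub>0 \<and> max_coeff p q r = int s\<^sub>0 + 1 \<and>
       height p q r = int s\<^sub>0 + 1) \<and>
    (t > 1 \<and> s\<^sub>0 \<ge> t\<^sub>0 \<and> ((t\<^sub>0, s\<^sub>0) = (t, p - s) \<or> (t\<^sub>0, s\<^sub>0) = (p - t, s)) \<longrightarrow>
       min_coeff p q r = - int s\<^sub>0 - 1 \<and> max_coeff p q r = int s\<^sub>0 \<and>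
       height p q r = int s\<^sub>0 + 1)"
proof -
  have t: "0 < t" "t < p" and s: "0 < s" "s < p" using assms(1,2,4) by auto
  have "p * 1 \<le> p * p" using assms(1) by (intro mult_le_mono) auto
  then have pq: "p < q" using assms(10) unfolding power2_eq_square by linarith
  have "1 mod p = 1" using assms(1) by simp
  then have st: "(s * t) mod p = 1" using assms(5) by (simp add: cong_def)
  have qt: "q mod p = t" using assms(11) t by (simp add: cong_def)
  have "[s * q = s * t] (mod p)" using assms(11) by (rule cong_scalar_left)
  then have sq: "[s * q = 1] (mod p)" using assms(5) by (rule cong_trans)
  have "r * 1 \<le> r * t" using t by (intro mult_le_mono) auto
  then have rt1: "1 < r * t" using assms(8) pq assms(1) by linarith
  then have "p * q dvd r * t - 1" using assms(12) by (metis cong_altdef_nat less_imp_le)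
  then have "p * q \<le> r * t - 1" using rt1 by (intro dvd_imp_le) linarith+
  then have r: "p + q \<le> r" using assms(1,10) t by (intro ternary_r_large) auto
  have "int p * int q dvd int r' * int t + 1" using assms(13) by (simp add: cong_iff_dvd_diff)
  then have "int (p * q) dvd int (r' * t + 1)" by (simp add: add.commute)
  then have "p * q dvd r' * t + 1" by (simp only: int_dvd_int_iff)
  then have "p * q \<le> r' * t + 1" by (intro dvd_imp_le) auto
  then have r': "p + q \<le> r'" using assms(1,10) t by (intro ternary_r_large) auto
  have "[int (r * t) = int 1] (mod int (p * q))" using assms(12) by (simp only: cong_int_iff)
  then have rt: "[int r * int t = 1] (mod int p * int q)" by simp
  have rt': "[int r' * - int t = 1] (mod int p * int q)"
    using cong_minus_minus_iff[of "int r' * - int t" 1 "int p * int q"] assms(13) by simp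
  interpret T: ternary_poly p q r s "int t"
    by unfold_locales (use assms(1) pq sq rt r in auto)
  interpret T': ternary_poly p q r' s "- int t"
    by unfold_locales (use assms(1) pq sq rt' r' in auto)
  interpret C: ternary "int p" "int q" "int t" "int s"
  proof unfold_locales
    show "(int s * int t) mod int p = 1" using st by (metis of_nat_1 of_nat_mod of_nat_mult)
    show "int p * int p < int q" using assms(10) by (simp add: power2_eq_square flip: of_nat_mult)
    show "int q mod int p = int t" using qt by (metis of_nat_mod)
  qed (use assms(1) t s in auto)
  have neg: "T'.ksum N (int q + int p - 1 - v) = - T.ksum N v" for N v by (rule kaplan_sum_uminus)
  have sets: "coeff_set p q r' = uminus ` coeff_set p q r"
  proof (intro equalityI subsetI)
    fix x assume "x \<in> coeff_set p q r'"
    then obtain N v where "x = T'.ksum N v" "0 \<le> N" unfolding T'.coeff_set_eq by blast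
    then have "x = - T.ksum N (int q + int p - 1 - v)"
      using neg[of N "int q + int p - 1 - v"] by simp
    then show "x \<in> uminus ` coeff_set p q r" unfolding T.coeff_set_eq using \<open>0 \<le> N\<close> by blast
  next
    fix x assume "x \<in> uminus ` coeff_set p q r"
    then obtain N v where "x = - T.ksum N v" "0 \<le> N" unfolding T.coeff_set_eq by blast
    then show "x \<in> coeff_set p q r'" unfolding T'.coeff_set_eq neg[symmetric] by blast
  qed
  have bounds: "C.lower \<le> x \<and> x \<le> C.upper" if "x \<in> coeff_set p q r" for x
    using T.coeff_set_small[OF that] C.kaplan_sum_bounds by metis
  have one: "C.lower = -1 \<and> C.upper = 1" if "t = 1" "s = 1"
    unfolding C.lower_def C.upper_def using that assms(1) by auto
  have "C.lower \<in> coeff_set p q r \<and> C.upper \<in> coeff_set p q r"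
  proof (cases "t = 1")
    case True
    then have "s = 1" using st s by simp
    \<comment> \<open>Here 2s < p, and the witnesses for that case rely on an upward wrap, which
      needs t > 1; the coefficients of x^0 and x^q take their place.\<close>
    have "coeff T.poly_T m \<in> coeff_set p q r" for m
      unfolding T.coeff_set_eq T.coeff_T by (metis (mono_tags, lifting) mem_Collect_eq of_nat_0_le_iff)
    from this[of 0] this[of q] show ?thesis
      unfolding T.small_coeffs using one[OF True \<open>s = 1\<close>] by simp
  next
    case False
    have "int p * int q dvd int r * int t - 1" using rt by (simp add: cong_iff_dvd_diff)
    moreover have "1 < int t" using False t by simp
    ultimately obtain N v N' v' where "0 \<le> N" "T.ksum N v = C.upper" "0 \<le> N'" "T.ksum N' v' = C.lower"
      using C.extremes_attained[of "int r"] by blast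
    then show ?thesis unfolding T.coeff_set_eq by (metis (mono_tags, lifting) mem_Collect_eq)
  qed
  moreover have "C.lower \<le> 0" "0 \<le> C.upper" using s by (auto simp: C.lower_def C.upper_def)
  ultimately have ex: "min_coeff p q r = C.lower" "max_coeff p q r = C.upper"
    "height p q r = max C.upper (- C.lower)"
    unfolding min_coeff_def max_coeff_def height_def
    using Max_Min_eqI[of "coeff_set p q r" C.lower C.upper] bounds by auto
  have s2: "2 * s \<noteq> p" using C.two_s by linarith
  have t2: "2 * t \<noteq> p"
  proof
    assume "2 * t = p"
    then have "t dvd p" by (metis dvd_triv_right)
    then have "t = 1" using coprime_common_divisor[OF assms(3), of t] by simp
    then show False using \<open>2 * t = p\<close> assms(1) by simp
  qed
  \<comment> \<open>With 2s and 2t both different from p, case (iii) means that t and s lie on the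
    same side of p/2 and case (iv) that they lie on opposite sides; this decides the extra 1 in
    \<open>C.upper\<close> and \<open>C.lower\<close>.\<close>
  show ?thesis
    unfolding ex using sets one s2 t2 t s
    unfolding assms(6,7) C.lower_def C.upper_def
    by (auto simp: min_def max_def of_nat_diff split: if_splits)
qed

end
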